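(* Let $\mathcal{X}\subset\mathbb{R}^d$ be compact, $k$ a positive definite kernel with $k(x,x)\le 1$, and $f\in\mathcal{H}_k$. Let $T=NL$. Assume all kernel matrices of the queried points are invertible and all maximizers below exist. Run Algorithm 2: for $n=1,\dots,N$, choose the batch $X_n=(x_{(n-1)L+1},\dots,x_{nL})$ as a maximizer over $X=(z_1,\dots,z_L)\in\mathcal{X}^L$ of $$\frac1L\sum_{i=1}^L m_{(n-1)L}(z_i)+\|f\|_{\mathcal{H}_k}\left(2\sqrt{\frac{\operatorname{tr}(\operatorname{cov}_{n-1}(X,X))}{L}}-\sqrt{\frac{\mathbf{1}^T\operatorname{cov}_{n-1}(X,X)\mathbf{1}}{L^2}}\right),$$ then observe $f$ at all points of $X_n$. Fix $\sigma>0$, let $\beta=\max_{n\in\{1,\dots,N\}}\|\widehat{\operatorname{cov}}_{n-1}(X_n,X_n)\|_2$ (spectral norm), assume $\beta>0$, and let $C_2=\frac{8\beta}{\log(1+\beta\sigma^{-2})}$. Then $$R_T\le\|f\|_{\mathcal{H}_k}\sqrt{TC_2\gamma_T},\qquad r_T\le\|f\|_{\mathcal{H}_k}\sqrt{\frac{C_2\gamma_T}{T}}.$$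
   Context: For query points $x_1,\dots,x_t$: $\mathbf{k}_t(x)=[k(x,x_1),\dots,k(x,x_t)]^T$, $\mathbf{K}_t=[k(x_i,x_j)]_{i,j\le t}$, $\mathbf{f}_t=[f(x_i)]_{i\le t}$, $m_t(x)=\mathbf{k}_t(x)^T\mathbf{K}_t^{-1}\mathbf{f}_t$ ($m_0\equiv0$). $\overline X_n=\{x_1,\dots,x_{nL}\}$ denotes all points of the first $n$ batches. For an $L$-tuple $X$, $\mathbf{K}(X,X)$ is the $L\times L$ kernel matrix and $\mathbf{K}(\overline X_n,X)$ the $nL\times L$ cross kernel matrix; $\operatorname{cov}_n(X,X)=\mathbf{K}(X,X)-\mathbf{K}(\overline X_n,X)^T\mathbf{K}(\overline X_n,\overline X_n)^{-1}\mathbf{K}(\overline X_n,X)$ and $\widehat{\operatorname{cov}}_n(X,X)=\mathbf{K}(X,X)-\mathbf{K}(\overline X_n,X)^T(\sigma^2I+\mathbf{K}(\overline X_n,\overline X_n))^{-1}\mathbf{K}(\overline X_n,X)$, with $\operatorname{cov}_0=\widehat{\operatorname{cov}}_0=\mathbf{K}(X,X)$. $x^*\in\arg\max_{\mathcal{X}}f$, $R_T=\sum_{t=1}^T(f(x^* )-f(x_t))$, $r_T=f(x^* )-\max_{t\le T}f(x_t)$, $\gamma_T=\max_{x_1,\dots,x_T\in\mathcal{X}}\frac12\log\det(\mathbf{I}_T+\sigma^{-2}\mathbf{K}_T)$. *)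

theory Defs
  imports "HOL-Analysis.Analysis" "Jordan_Normal_Form.Matrix" "Jordan_Normal_Form.Determinant"
begin

section \<open>Kernels and their RKHS (Moore--Aronszajn construction)\<close>

definition pd_kernel :: "'a set \<Rightarrow> ('a \<Rightarrow> 'a \<Rightarrow> real) \<Rightarrow> bool" where
  "pd_kernel X k \<longleftrightarrow>
     (\<forall>x\<in>X. \<forall>y\<in>X. k x y = k y x) \<and>
     (\<forall>(n::nat) (c::nat \<Rightarrow> real) z. (\<forall>i<n. z i \<in> X) \<longrightarrow>
         0 \<le> (\<Sum>i<n. \<Sum>j<n. c i * c j * k (z i) (z j)))"

text \<open>Finitely supported coefficient functions with support in X describe the elements
  sum_y c(y) k(., y) of the pre-RKHS (the span of the kernel sections).\<close>
definition fin_coeffs :: "'a set \<Rightarrow> ('a \<Rightarrow> real) \<Rightarrow> bool" where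
  "fin_coeffs X c \<longleftrightarrow> finite {y. c y \<noteq> 0} \<and> {y. c y \<noteq> 0} \<subseteq> X"

definition kspan_fun :: "('a \<Rightarrow> 'a \<Rightarrow> real) \<Rightarrow> ('a \<Rightarrow> real) \<Rightarrow> 'a \<Rightarrow> real" where
  "kspan_fun k c = (\<lambda>x. \<Sum>y\<in>{y. c y \<noteq> 0}. c y * k x y)"

definition kspan_sqnorm :: "('a \<Rightarrow> 'a \<Rightarrow> real) \<Rightarrow> ('a \<Rightarrow> real) \<Rightarrow> real" where
  "kspan_sqnorm k c = (\<Sum>y\<in>{y. c y \<noteq> 0}. \<Sum>z\<in>{y. c y \<noteq> 0}. c y * c z * k y z)"

definition approx_seq :: "('a \<Rightarrow> 'a \<Rightarrow> real) \<Rightarrow> 'a set \<Rightarrow> ('a \<Rightarrow> real) \<Rightarrow> (nat \<Rightarrow> 'a \<Rightarrow> real) \<Rightarrow> bool" where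
  "approx_seq k X f cs \<longleftrightarrow>
     (\<forall>n. fin_coeffs X (cs n)) \<and>
     (\<forall>e>0. \<exists>N. \<forall>m\<ge>N. \<forall>n\<ge>N. kspan_sqnorm k (\<lambda>y. cs m y - cs n y) < e) \<and>
     (\<forall>x\<in>X. (\<lambda>n. kspan_fun k (cs n) x) \<longlonglongrightarrow> f x)"

text \<open>Membership in the RKHS H_k (completion of the pre-RKHS, realised as functions on X).\<close>
definition in_rkhs :: "('a \<Rightarrow> 'a \<Rightarrow> real) \<Rightarrow> 'a set \<Rightarrow> ('a \<Rightarrow> real) \<Rightarrow> bool" where
  "in_rkhs k X f \<longleftrightarrow> (\<exists>cs. approx_seq k X f cs)"

text \<open>RKHS norm: limit of the pre-RKHS norms along any approximating Cauchy sequence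
  (this limit does not depend on the sequence).\<close>
definition rkhs_norm :: "('a \<Rightarrow> 'a \<Rightarrow> real) \<Rightarrow> 'a set \<Rightarrow> ('a \<Rightarrow> real) \<Rightarrow> real" where
  "rkhs_norm k X f = Inf {l. \<exists>cs. approx_seq k X f cs \<and>
                              (\<lambda>n. sqrt (kspan_sqnorm k (cs n))) \<longlonglongrightarrow> l}"

definition minv :: "real mat \<Rightarrow> real mat" where
  "minv A = (SOME B. inverts_mat A B \<and> inverts_mat B A)"

text \<open>Queried points are xs 1, xs 2, ...; K_t is the kernel matrix of xs 1..xs t.\<close>
definition Kmat :: "('a \<Rightarrow> 'a \<Rightarrow> real) \<Rightarrow> (nat \<Rightarrow> 'a) \<Rightarrow> nat \<Rightarrow> real mat" where
  "Kmat k xs t = mat t t (\<lambda>(i, j). k (xs (Suc i)) (xs (Suc j)))"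

text \<open>m_t(x) = k_t(x)^T K_t^{-1} f_t  (m_0 = 0 automatically).\<close>
definition post_mean :: "('a \<Rightarrow> 'a \<Rightarrow> real) \<Rightarrow> (nat \<Rightarrow> 'a) \<Rightarrow> ('a \<Rightarrow> real) \<Rightarrow> nat \<Rightarrow> 'a \<Rightarrow> real" where
  "post_mean k xs f t x =
     scalar_prod (Matrix.vec t (\<lambda>i. k x (xs (Suc i))))
                 (minv (Kmat k xs t) *\<^sub>v Matrix.vec t (\<lambda>i. f (xs (Suc i))))"

text \<open>An L-tuple z = (z 0, ..., z (L-1)).  Cross kernel matrix K(first t points, z) (t x L).\<close>
definition cross_mat :: "('a \<Rightarrow> 'a \<Rightarrow> real) \<Rightarrow> (nat \<Rightarrow> 'a) \<Rightarrow> nat \<Rightarrow> nat \<Rightarrow> (nat \<Rightarrow> 'a) \<Rightarrow> real mat" where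
  "cross_mat k xs t L z = mat t L (\<lambda>(i, j). k (xs (Suc i)) (z j))"

definition tuple_mat :: "('a \<Rightarrow> 'a \<Rightarrow> real) \<Rightarrow> nat \<Rightarrow> (nat \<Rightarrow> 'a) \<Rightarrow> real mat" where
  "tuple_mat k L z = mat L L (\<lambda>(i, j). k (z i) (z j))"

text \<open>cov conditioned on the first t queried points (t = nL gives cov_n).\<close>
definition post_cov :: "('a \<Rightarrow> 'a \<Rightarrow> real) \<Rightarrow> (nat \<Rightarrow> 'a) \<Rightarrow> nat \<Rightarrow> nat \<Rightarrow> (nat \<Rightarrow> 'a) \<Rightarrow> real mat" where
  "post_cov k xs t L z =
     tuple_mat k L z - transpose_mat (cross_mat k xs t L z) * minv (Kmat k xs t) * cross_mat k xs t L z"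

definition post_cov_noisy :: "('a \<Rightarrow> 'a \<Rightarrow> real) \<Rightarrow> real \<Rightarrow> (nat \<Rightarrow> 'a) \<Rightarrow> nat \<Rightarrow> nat \<Rightarrow> (nat \<Rightarrow> 'a) \<Rightarrow> real mat" where
  "post_cov_noisy k \<sigma> xs t L z =
     tuple_mat k L z - transpose_mat (cross_mat k xs t L z)
        * minv ((\<sigma>\<^sup>2 \<cdot>\<^sub>m 1\<^sub>m t) + Kmat k xs t) * cross_mat k xs t L z"

definition mtrace :: "real mat \<Rightarrow> real" where
  "mtrace A = (\<Sum>i<dim_row A. A $$ (i, i))"

definition ones_quad :: "real mat \<Rightarrow> real" where
  "ones_quad A = (\<Sum>i<dim_row A. \<Sum>j<dim_col A. A $$ (i, j))"

definition vnorm :: "real vec \<Rightarrow> real" where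
  "vnorm v = sqrt (\<Sum>i<dim_vec v. (v $ i)\<^sup>2)"

definition spec_norm :: "real mat \<Rightarrow> real" where
  "spec_norm A = Sup {vnorm (A *\<^sub>v v) | v. v \<in> carrier_vec (dim_col A) \<and> vnorm v \<le> 1}"

text \<open>The n-th batch X_n = (x_{(n-1)L+1}, ..., x_{nL}) as an L-tuple indexed 0..L-1.\<close>
definition batch :: "(nat \<Rightarrow> 'a) \<Rightarrow> nat \<Rightarrow> nat \<Rightarrow> nat \<Rightarrow> 'a" where
  "batch xs n L = (\<lambda>i. xs ((n - 1) * L + Suc i))"

text \<open>Acquisition function of Algorithm 2 for the n-th batch, evaluated at an L-tuple z
  (fnorm stands for the RKHS norm of f).\<close>
definition acq :: "('a \<Rightarrow> 'a \<Rightarrow> real) \<Rightarrow> ('a \<Rightarrow> real) \<Rightarrow> real \<Rightarrow> (nat \<Rightarrow> 'a) \<Rightarrow> nat \<Rightarrow> nat \<Rightarrow> (nat \<Rightarrow> 'a) \<Rightarrow> real" where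
  "acq k f fnorm xs n L z =
     (let C = post_cov k xs ((n - 1) * L) L z in
       (1 / real L) * (\<Sum>i<L. post_mean k xs f ((n - 1) * L) (z i))
       + fnorm * (2 * sqrt (mtrace C / real L) - sqrt (ones_quad C / (real L)\<^sup>2)))"

definition info_gain :: "('a \<Rightarrow> 'a \<Rightarrow> real) \<Rightarrow> real \<Rightarrow> (nat \<Rightarrow> 'a) \<Rightarrow> nat \<Rightarrow> real" where
  "info_gain k \<sigma> xs T = 1 / 2 * ln (det (1\<^sub>m T + (1 / \<sigma>\<^sup>2) \<cdot>\<^sub>m Kmat k xs T))"

definition max_info_gain :: "('a \<Rightarrow> 'a \<Rightarrow> real) \<Rightarrow> 'a set \<Rightarrow> real \<Rightarrow> nat \<Rightarrow> real" where
  "max_info_gain k X \<sigma> T = (SUP xs \<in> {xs. \<forall>i\<in>{1..T}. xs i \<in> X}. info_gain k \<sigma> xs T)"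

end

theory Submission
  imports Defs "Jordan_Normal_Form.Schur_Decomposition"
begin

text \<open>
  The posterior mean error on a tuple is a finite combination of values of f whose Gram form is the
  posterior covariance form, so it is bounded by the RKHS norm times the square root of that form.
  Comparing the chosen batch with the constant tuple at the maximizer, the terms with the all-ones
  form cancel and the batch regret is at most twice the norm of f times the square root of L times
  the trace of the posterior covariance. Conditioning without noise only decreases that form, and
  since ln (1 + x) is concave, a psd matrix of spectral norm at most \<open>\<beta>\<close> has trace at most
  \<open>\<beta> / ln (1 + \<beta> / \<sigma>\<^sup>2)\<close> times the log-determinant of \<open>I + \<sigma>\<^sup>-\<^sup>2 A\<close>. The log-determinants of the
  batches telescope to twice the information gain by Schur complements, and Cauchy--Schwarz over the
  batches finishes the proof.
\<close>

subsection \<open>Traces and determinants of real symmetric matrices\<close>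

lemma mtrace_mult_commute:
  assumes A: "A \<in> carrier_mat n m" and B: "B \<in> carrier_mat m n"
  shows "mtrace (A * B) = mtrace (B * A)"
proof -
  have "mtrace (A * B) = (\<Sum>i<n. \<Sum>j<m. A $$ (i, j) * B $$ (j, i))"
    using A B by (auto simp: mtrace_def scalar_prod_def atLeast0LessThan intro!: sum.cong)
  also have "\<dots> = (\<Sum>j<m. \<Sum>i<n. B $$ (j, i) * A $$ (i, j))"
    by (subst sum.swap) (simp add: mult.commute)
  also have "\<dots> = mtrace (B * A)"
    using A B by (auto simp: mtrace_def scalar_prod_def atLeast0LessThan intro!: sum.cong)
  finally show ?thesis .
qed

text \<open>For an eigenvector \<open>v\<close>, the Hermitian form \<open>S\<close> of
  \<open>A\<close> at \<open>v\<close> equals \<open>e\<close> times the squared norm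
  \<open>q\<close> of \<open>v\<close>. Symmetry of the real matrix makes \<open>S\<close> its own
  conjugate, and \<open>q\<close> is a nonzero real, so \<open>e\<close> is its own conjugate
  too.\<close>

lemma symmetric_eigenvalue_real:
  fixes A :: "real mat"
  assumes A: "A \<in> carrier_mat n n" and sym: "transpose_mat A = A"
    and ev: "eigenvalue (map_mat complex_of_real A) e"
  shows "e \<in> \<real>"
proof -
  from ev obtain v where v: "v \<in> carrier_vec n" "v \<noteq> 0\<^sub>v n"
    and Av: "map_mat complex_of_real A *\<^sub>v v = e \<cdot>\<^sub>v v"
    using A unfolding eigenvalue_def eigenvector_def by auto
  have A_sym: "A $$ (i, j) = A $$ (j, i)" if "i < n" "j < n" for i j
    using that A sym by (metis carrier_matD index_transpose_mat(1))
  define S where "S = (\<Sum>i<n. \<Sum>j<n. cnj (vec_index v i) * of_real (A $$ (i, j)) * vec_index v j)"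
  define q where "q = (\<Sum>i<n. (cmod (vec_index v i))\<^sup>2)"
  have comp: "(\<Sum>j<n. of_real (A $$ (i, j)) * vec_index v j) = e * vec_index v i" if "i < n" for i
  proof -
    have "vec_index (map_mat complex_of_real A *\<^sub>v v) i = vec_index (e \<cdot>\<^sub>v v) i" using Av by simp
    then show ?thesis using that A v by (simp add: scalar_prod_def atLeast0LessThan)
  qed
  have "S = (\<Sum>i<n. cnj (vec_index v i) * (\<Sum>j<n. of_real (A $$ (i, j)) * vec_index v j))"
    by (simp add: S_def sum_distrib_left mult.assoc)
  also have "\<dots> = (\<Sum>i<n. e * (vec_index v i * cnj (vec_index v i)))"
    by (intro sum.cong) (auto simp: comp)
  also have "\<dots> = e * of_real q"
    by (simp add: q_def sum_distrib_left complex_norm_square[symmetric])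
  finally have S: "S = e * of_real q" .
  have "cnj S = (\<Sum>i<n. \<Sum>j<n. vec_index v i * of_real (A $$ (i, j)) * cnj (vec_index v j))"
    by (simp add: S_def)
  also have "\<dots> = S"
    unfolding S_def by (subst sum.swap, intro sum.cong refl) (auto simp: A_sym)
  finally have "cnj S = S" .
  moreover have "q \<noteq> 0"
  proof
    assume "q = 0"
    then have "\<forall>i<n. vec_index v i = 0" unfolding q_def by (subst (asm) sum_nonneg_eq_0_iff) auto
    then have "v = 0\<^sub>v n" using v(1) by (intro eq_vecI) auto
    with v show False by simp
  qed
  ultimately have "cnj e = e" using S by auto
  then show ?thesis by (simp add: Reals_cnj_iff)
qed

text \<open>Over the complex numbers the characteristic polynomial factors into linear terms. Its
  roots are real by \<open>symmetric_eigenvalue_real\<close>, so the factorization descends to real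
  coefficients.\<close>

lemma symmetric_char_poly_splits:
  fixes A :: "real mat"
  assumes A: "A \<in> carrier_mat n n" and sym: "transpose_mat A = A"
  shows "\<exists>es. char_poly A = (\<Prod>e\<leftarrow>es. [:- e, 1:])"
proof -
  let ?A = "map_mat complex_of_real A"
  have cA: "?A \<in> carrier_mat n n" using A by auto
  obtain as where as: "char_poly ?A = (\<Prod>a\<leftarrow>as. [:- a, 1:])"
    using char_poly_factorized[OF cA] by blast
  have real: "a \<in> \<real>" if "a \<in> set as" for a
  proof (rule symmetric_eigenvalue_real[OF A sym])
    show "eigenvalue ?A a"
      unfolding eigenvalue_root_char_poly[OF cA] as using that by (induction as) auto
  qed
  have "map_poly complex_of_real (char_poly A) = (\<Prod>a\<leftarrow>as. [:- a, 1:])"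
    using as of_real_hom.char_poly_hom[OF A] by metis
  also have "\<dots> = map_poly complex_of_real (\<Prod>e\<leftarrow>map Re as. [:- e, 1:])"
    using real
  proof (induction as)
    case (Cons a as)
    interpret map_poly_comm_ring_hom complex_of_real ..
    have "complex_of_real (Re a) = a" using Cons.prems by (auto simp: Reals_def)
    with Cons show ?case by (simp add: hom_distribs)
  qed simp
  finally have "char_poly A = (\<Prod>e\<leftarrow>map Re as. [:- e, 1:])"
    by (simp add: poly_eq_iff coeff_map_poly)
  then show ?thesis by blast
qed

text \<open>Once the characteristic polynomial splits, Schur decomposition gives a similar upper
  triangular matrix \<open>B\<close>. Trace and \<open>det (1 + c A)\<close> are similarity
  invariants, and for \<open>B\<close> both are read off the diagonal, which supplies
  \<open>d\<close>.\<close>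

lemma symmetric_trace_det_eigenvalues:
  fixes A :: "real mat"
  assumes A: "A \<in> carrier_mat n n" and sym: "transpose_mat A = A"
  obtains d :: "nat \<Rightarrow> real" where "\<And>i. i < n \<Longrightarrow> eigenvalue A (d i)"
    and "mtrace A = (\<Sum>i<n. d i)"
    and "\<And>c. det (1\<^sub>m n + c \<cdot>\<^sub>m A) = (\<Prod>i<n. 1 + c * d i)"
proof -
  obtain es where es: "char_poly A = (\<Prod>e\<leftarrow>es. [:- e, 1:])"
    using symmetric_char_poly_splits[OF assms] by blast
  obtain B P Q where "schur_decomposition A es = (B, P, Q)" by (metis surj_pair)
  from schur_decomposition[OF A es this] have wit: "similar_mat_wit A B P Q"
    and ut: "upper_triangular B" and diag: "diag_mat B = es" by auto
  from similar_mat_witD2[OF A wit] have car: "B \<in> carrier_mat n n" "P \<in> carrier_mat n n" "Q \<in> carrier_mat n n"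
    and PQ: "P * Q = 1\<^sub>m n" "Q * P = 1\<^sub>m n" and AB: "A = P * B * Q" by auto
  show thesis
  proof
    show "eigenvalue A (B $$ (i, i))" if "i < n" for i
    proof -
      have "B $$ (i, i) \<in> set es" using that car unfolding diag[symmetric] diag_mat_def by auto
      then show ?thesis unfolding eigenvalue_root_char_poly[OF A] es by (induction es) auto
    qed
    have "mtrace A = mtrace (Q * (P * B))"
      unfolding AB by (rule mtrace_mult_commute) (use car in auto)
    also have "Q * (P * B) = B" using car PQ by (simp flip: assoc_mult_mat)
    finally show "mtrace A = (\<Sum>i<n. B $$ (i, i))" using car by (simp add: mtrace_def)
    show "det (1\<^sub>m n + c \<cdot>\<^sub>m A) = (\<Prod>i<n. 1 + c * B $$ (i, i))" for c
    proof -
      have cB: "1\<^sub>m n + c \<cdot>\<^sub>m B \<in> carrier_mat n n" using car by auto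
      have "P * (1\<^sub>m n + c \<cdot>\<^sub>m B) * Q = (P * 1\<^sub>m n + P * (c \<cdot>\<^sub>m B)) * Q"
        using car by (subst mult_add_distrib_mat) auto
      also have "\<dots> = P * Q + P * (c \<cdot>\<^sub>m B) * Q"
        using car by (subst add_mult_distrib_mat) auto
      also have "\<dots> = 1\<^sub>m n + c \<cdot>\<^sub>m A"
        unfolding AB PQ using car by (simp add: mult_smult_distrib mult_smult_assoc_mat[of _ n n])
      finally have eq: "1\<^sub>m n + c \<cdot>\<^sub>m A = P * (1\<^sub>m n + c \<cdot>\<^sub>m B) * Q" ..
      have "similar_mat (1\<^sub>m n + c \<cdot>\<^sub>m A) (1\<^sub>m n + c \<cdot>\<^sub>m B)"
        by (rule similar_matI[of _ _ P Q n]) (use A car PQ eq in auto)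
      then have "det (1\<^sub>m n + c \<cdot>\<^sub>m A) = det (1\<^sub>m n + c \<cdot>\<^sub>m B)" by (rule det_similar)
      also have "\<dots> = prod_list (diag_mat (1\<^sub>m n + c \<cdot>\<^sub>m B))"
        by (rule det_upper_triangular[OF _ cB]) (use ut car in \<open>auto simp: upper_triangular_def\<close>)
      also have "\<dots> = (\<Prod>i<n. 1 + c * B $$ (i, i))"
        using car by (auto simp: prod_list_diag_prod atLeast0LessThan intro!: prod.cong)
      finally show ?thesis .
    qed
  qed
qed


text \<open>Symmetry is stated explicitly, since a nonnegative quadratic form over the reals does
  not force it.\<close>

definition psd_mat :: "real mat \<Rightarrow> bool" where
  "psd_mat A \<longleftrightarrow> transpose_mat A = A \<and> (\<forall>v\<in>carrier_vec (dim_col A). 0 \<le> scalar_prod v (A *\<^sub>v v))"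

section \<open>Eigenvalues, spectral norm and determinant of positive semidefinite matrices\<close>

lemma vnorm_smult: "vnorm (c \<cdot>\<^sub>v v) = \<bar>c\<bar> * vnorm v"
  by (simp add: vnorm_def power_mult_distrib real_sqrt_mult flip: sum_distrib_left)

lemma scalar_prod_self: "scalar_prod v v = (vnorm v)\<^sup>2"
  by (simp add: vnorm_def scalar_prod_def sum_nonneg atLeast0LessThan power2_eq_square)

lemma vnorm_pos:
  assumes "v \<in> carrier_vec n" "v \<noteq> 0\<^sub>v n"
  shows "0 < vnorm v"
proof -
  obtain i where i: "i < n" "vec_index v i \<noteq> 0" using assms by (metis carrier_vecD eq_vecI index_zero_vec)
  have "0 < (\<Sum>i<n. (vec_index v i)\<^sup>2)" by (rule sum_pos2[of _ i]) (use i in auto)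
  then show ?thesis using assms by (simp add: vnorm_def)
qed

text \<open>Makes the supremum in \<open>spec_norm\<close> usable as an upper bound. Entries of a
  vector in the unit ball are at most 1 in absolute value, so each component of the image is bounded
  by an absolute row sum.\<close>

lemma bdd_above_vnorm_image:
  "bdd_above {vnorm (A *\<^sub>v v) | v. v \<in> carrier_vec (dim_col A) \<and> vnorm v \<le> 1}"
proof -
  have "vnorm (A *\<^sub>v v) \<le> sqrt (\<Sum>i<dim_row A. (\<Sum>j<dim_col A. \<bar>A $$ (i, j)\<bar>)\<^sup>2)"
    if v: "v \<in> carrier_vec (dim_col A)" "vnorm v \<le> 1" for v
  proof -
    have v1: "\<bar>vec_index v j\<bar> \<le> 1" if "j < dim_col A" for j
    proof -
      have "(vec_index v j)\<^sup>2 \<le> (\<Sum>i<dim_vec v. (vec_index v i)\<^sup>2)"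
        by (rule member_le_sum) (use v that in auto)
      also have "\<dots> \<le> 1" using v by (simp add: vnorm_def)
      finally show ?thesis by (simp add: abs_square_le_1)
    qed
    have "\<bar>vec_index (A *\<^sub>v v) i\<bar> \<le> (\<Sum>j<dim_col A. \<bar>A $$ (i, j)\<bar>)" if "i < dim_row A" for i
    proof -
      have "\<bar>vec_index (A *\<^sub>v v) i\<bar> = \<bar>\<Sum>j<dim_col A. A $$ (i, j) * vec_index v j\<bar>"
        using that v by (simp add: scalar_prod_def atLeast0LessThan)
      also have "\<dots> \<le> (\<Sum>j<dim_col A. \<bar>A $$ (i, j) * vec_index v j\<bar>)" by (rule sum_abs)
      also have "\<dots> \<le> (\<Sum>j<dim_col A. \<bar>A $$ (i, j)\<bar>)"
        by (intro sum_mono) (use v1 in \<open>auto simp: abs_mult intro: mult_left_le\<close>)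
      finally show ?thesis .
    qed
    then show ?thesis
      unfolding vnorm_def
      by (intro real_sqrt_le_mono) (auto intro!: sum_mono simp: abs_le_square_iff[symmetric] sum_nonneg)
  qed
  then show ?thesis by (intro bdd_aboveI) auto
qed

text \<open>A normalised eigenvector is a competitor in the supremum, with image of norm
  \<open>\<bar>e\<bar>\<close>.\<close>

lemma abs_eigenvalue_le_spec_norm:
  assumes A: "A \<in> carrier_mat n n" and ev: "eigenvalue A e"
  shows "\<bar>e\<bar> \<le> spec_norm A"
proof -
  from ev A obtain v where v: "v \<in> carrier_vec n" "v \<noteq> 0\<^sub>v n" and Av: "A *\<^sub>v v = e \<cdot>\<^sub>v v"
    unfolding eigenvalue_def eigenvector_def by auto
  note pos = vnorm_pos[OF v]
  define u where "u = (1 / vnorm v) \<cdot>\<^sub>v v"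
  have u: "u \<in> carrier_vec n" "vnorm u = 1" using v pos by (auto simp: u_def vnorm_smult)
  have "A *\<^sub>v u = e \<cdot>\<^sub>v u"
    unfolding u_def using A v Av by (simp add: mult_mat_vec smult_smult_assoc mult.commute)
  then have "vnorm (A *\<^sub>v u) = \<bar>e\<bar>" using u by (simp add: vnorm_smult)
  moreover have "vnorm (A *\<^sub>v u) \<le> spec_norm A"
    unfolding spec_norm_def by (rule cSup_upper[OF _ bdd_above_vnorm_image]) (use u A in auto)
  ultimately show ?thesis by simp
qed

lemma psd_mat_eigenvalue_nonneg:
  assumes A: "A \<in> carrier_mat n n" "psd_mat A" and ev: "eigenvalue A e"
  shows "0 \<le> e"
proof -
  from ev A obtain v where v: "v \<in> carrier_vec n" "v \<noteq> 0\<^sub>v n" and Av: "A *\<^sub>v v = e \<cdot>\<^sub>v v"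
    unfolding eigenvalue_def eigenvector_def by auto
  have "0 \<le> scalar_prod v (A *\<^sub>v v)" using A v by (auto simp: psd_mat_def)
  also have "\<dots> = e * (vnorm v)\<^sup>2" using v by (simp add: Av scalar_prod_self)
  finally show ?thesis using vnorm_pos[OF v] by (simp add: zero_le_mult_iff)
qed

lemma psd_mat_det_pos:
  assumes A: "A \<in> carrier_mat n n" "psd_mat A" and c: "0 \<le> c"
  shows "0 < det (1\<^sub>m n + c \<cdot>\<^sub>m A)"
proof -
  obtain d where d: "\<And>i. i < n \<Longrightarrow> eigenvalue A (d i)"
    and det: "\<And>c. det (1\<^sub>m n + c \<cdot>\<^sub>m A) = (\<Prod>i<n. 1 + c * d i)"
    using symmetric_trace_det_eigenvalues[OF A(1)] A(2) unfolding psd_mat_def by metis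
  show ?thesis unfolding det
    by (intro prod_pos) (use psd_mat_eigenvalue_nonneg[OF A d] c in \<open>auto intro!: add_pos_nonneg\<close>)
qed

text \<open>By concavity the graph of \<open>ln (1 + x / s)\<close> lies above its chord over the
  interval from 0 to \<open>b\<close>. The point \<open>x\<close> corresponds to the weight
  \<open>x / b\<close> between the arguments \<open>1\<close> and \<open>1 + b / s\<close>.\<close>

lemma le_ln_chord:
  fixes x b s :: real
  assumes "0 \<le> x" "x \<le> b" "0 < b" "0 < s"
  shows "x \<le> b / ln (1 + b / s) * ln (1 + x / s)"
proof -
  have pos: "0 < ln (1 + b / s)" using assms by (intro ln_gt_zero) simp
  have "(1 - x / b) * ln 1 + (x / b) * ln (1 + b / s) \<le> ln ((1 - x / b) * 1 + (x / b) * (1 + b / s))"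
    using concave_onD[OF ln_concave, of "x / b" 1 "1 + b / s"] assms by (simp add: add_pos_pos)
  also have "(1 - x / b) * 1 + (x / b) * (1 + b / s) = 1 + x / s" using assms by (simp add: field_simps)
  finally have "(x / b) * ln (1 + b / s) \<le> ln (1 + x / s)" by simp
  then show ?thesis using pos assms by (simp add: field_simps)
qed

text \<open>All eigenvalues lie between 0 and \<open>b\<close>, so \<open>le_ln_chord\<close>
  applies to each of them. Summing turns the left side into the trace and the logarithms into the
  log-determinant. The factor \<open>b / ln (1 + b / s)\<close> is one eighth of the constant in the
  regret bound.\<close>

lemma mtrace_le_ln_det:
  assumes A: "A \<in> carrier_mat n n" "psd_mat A"
    and b: "spec_norm A \<le> b" "0 < b" and s: "0 < s"
  shows "mtrace A \<le> b / ln (1 + b / s) * ln (det (1\<^sub>m n + (1 / s) \<cdot>\<^sub>m A))"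
proof -
  obtain d where d: "\<And>i. i < n \<Longrightarrow> eigenvalue A (d i)" and tr: "mtrace A = (\<Sum>i<n. d i)"
    and det: "\<And>c. det (1\<^sub>m n + c \<cdot>\<^sub>m A) = (\<Prod>i<n. 1 + c * d i)"
    using symmetric_trace_det_eigenvalues[OF A(1)] A(2) unfolding psd_mat_def by metis
  have d0: "0 \<le> d i" if "i < n" for i by (rule psd_mat_eigenvalue_nonneg[OF A d[OF that]])
  have db: "d i \<le> b" if "i < n" for i using abs_eigenvalue_le_spec_norm[OF A(1) d[OF that]] b by simp
  have "mtrace A \<le> (\<Sum>i<n. b / ln (1 + b / s) * ln (1 + d i / s))"
    unfolding tr by (intro sum_mono le_ln_chord) (use d0 db b s in auto)
  also have "\<dots> = b / ln (1 + b / s) * ln (\<Prod>i<n. 1 + d i / s)"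
  proof -
    have "ln (\<Prod>i<n. 1 + d i / s) = (\<Sum>i<n. ln (1 + d i / s))"
    proof (rule ln_prod)
      show "1 + d i / s \<noteq> 0" if "i \<in> {..<n}" for i
        using divide_nonneg_pos[OF d0 s, of i] that by simp
    qed simp
    then show ?thesis by (simp add: sum_distrib_left)
  qed
  finally show ?thesis unfolding det by simp
qed

subsection \<open>Schur complements\<close>

lemma symmetric_scalar_prod_swap:
  fixes A :: "real mat"
  assumes "A \<in> carrier_mat n n" "transpose_mat A = A" "u \<in> carrier_vec n" "v \<in> carrier_vec n"
  shows "scalar_prod u (A *\<^sub>v v) = scalar_prod (A *\<^sub>v u) v"
  using transpose_vec_mult_scalar[of A n n v u] assms by simp

lemma minv_props:
  assumes A: "A \<in> carrier_mat n n" and inv: "invertible_mat A"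
  shows "minv A \<in> carrier_mat n n" "A * minv A = 1\<^sub>m n" "minv A * A = 1\<^sub>m n"
proof -
  have "\<exists>B. inverts_mat A B \<and> inverts_mat B A" using inv by (auto simp: invertible_mat_def)
  then have *: "inverts_mat A (minv A) \<and> inverts_mat (minv A) A"
    unfolding minv_def by (rule someI_ex)
  then have "A * minv A = 1\<^sub>m n" "minv A * A = 1\<^sub>m (dim_row (minv A))"
    using A by (auto simp: inverts_mat_def)
  \<comment> \<open>\<open>inverts_mat\<close> does not fix the shape of the inverse; counting
    columns in the two product identities does.\<close>
  moreover from arg_cong[OF this(1), of dim_col] arg_cong[OF this(2), of dim_col] A
  show "minv A \<in> carrier_mat n n" by auto
  ultimately show "A * minv A = 1\<^sub>m n" "minv A * A = 1\<^sub>m n" by auto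
qed

lemma minv_symmetric:
  assumes A: "A \<in> carrier_mat n n" and inv: "invertible_mat A" and sym: "transpose_mat A = A"
  shows "transpose_mat (minv A) = minv A"
proof -
  note I = minv_props[OF A inv]
  have "transpose_mat (minv A) * A = transpose_mat (A * minv A)"
    using I A sym by (subst transpose_mult) auto
  then have "transpose_mat (minv A) * A = 1\<^sub>m n" using I by simp
  then have "transpose_mat (minv A) * A * minv A = minv A" using I by simp
  then show ?thesis using A I by simp
qed

lemma invertible_mat_det:
  fixes A :: "real mat"
  assumes A: "A \<in> carrier_mat n n" and "det A \<noteq> 0"
  shows "invertible_mat A"
proof -
  have "A \<in> Units (ring_mat TYPE(real) n ())" by (rule det_non_zero_imp_unit[OF assms])
  then obtain B where "B \<in> carrier_mat n n" "A * B = 1\<^sub>m n" "B * A = 1\<^sub>m n"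
    unfolding Units_def by (simp add: ring_mat_def) blast
  then have "inverts_mat A B" "inverts_mat B A" using A by (simp_all add: inverts_mat_def)
  then show ?thesis using A unfolding invertible_mat_def by auto
qed

text \<open>Completing the square. The left side is the block quadratic form at
  \<open>(w, a)\<close>; for fixed \<open>a\<close> its stationary point is
  \<open>w = - A^{-1} B a\<close>, and \<open>u\<close> is the displacement from it.\<close>

lemma schur_complement_quadratic_form:
  assumes A: "A \<in> carrier_mat n n" and inv: "invertible_mat A" and sym: "transpose_mat A = A"
    and B: "B \<in> carrier_mat n m" and D: "D \<in> carrier_mat m m"
    and a: "a \<in> carrier_vec m" and w: "w \<in> carrier_vec n"
  defines "u \<equiv> w + minv A *\<^sub>v (B *\<^sub>v a)"
  shows "scalar_prod w (A *\<^sub>v w) + 2 * scalar_prod w (B *\<^sub>v a) + scalar_prod a (D *\<^sub>v a)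
       = scalar_prod a ((D - transpose_mat B * minv A * B) *\<^sub>v a) + scalar_prod u (A *\<^sub>v u)"
proof -
  note I = minv_props[OF A inv]
  define b where "b = B *\<^sub>v a"
  define v where "v = minv A *\<^sub>v b"
  have b: "b \<in> carrier_vec n" and v: "v \<in> carrier_vec n" using a B I by (auto simp: b_def v_def)
  have Av: "A *\<^sub>v v = b"
    using assoc_mult_mat_vec[OF A I(1) b] I b by (simp add: v_def)
  have Aw: "A *\<^sub>v w \<in> carrier_vec n" using A w by auto
  have "(D - transpose_mat B * minv A * B) *\<^sub>v a = D *\<^sub>v a - transpose_mat B *\<^sub>v v"
  proof -
    have BI: "transpose_mat B * minv A \<in> carrier_mat m n" using B I(1) by auto
    have "transpose_mat B * minv A * B *\<^sub>v a = transpose_mat B *\<^sub>v v"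
      unfolding assoc_mult_mat_vec[OF BI B a] b_def[symmetric] v_def
      by (rule assoc_mult_mat_vec[OF _ I(1) b]) (use B in simp)
    moreover have "(D - transpose_mat B * minv A * B) *\<^sub>v a
        = D *\<^sub>v a - transpose_mat B * minv A * B *\<^sub>v a"
      by (rule minus_mult_distrib_mat_vec[OF D _ a]) (rule mult_carrier_mat[OF BI B])
    ultimately show ?thesis by simp
  qed
  moreover have "scalar_prod a (D *\<^sub>v a - transpose_mat B *\<^sub>v v)
      = scalar_prod a (D *\<^sub>v a) - scalar_prod a (transpose_mat B *\<^sub>v v)"
    by (rule scalar_prod_minus_distrib[of _ m]) (use D B v a in auto)
  ultimately have "scalar_prod a ((D - transpose_mat B * minv A * B) *\<^sub>v a)
      = scalar_prod a (D *\<^sub>v a) - scalar_prod a (transpose_mat B *\<^sub>v v)" by simp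
  also have "scalar_prod a (transpose_mat B *\<^sub>v v) = scalar_prod v b"
    using transpose_vec_mult_scalar[OF B a v] comm_scalar_prod[OF a mult_mat_vec_carrier[OF _ v]] B
    by (simp add: b_def)
  finally have 1: "scalar_prod a ((D - transpose_mat B * minv A * B) *\<^sub>v a)
      = scalar_prod a (D *\<^sub>v a) - scalar_prod v b" .
  have u: "u = w + v" by (simp add: u_def b_def v_def)
  have "A *\<^sub>v u = A *\<^sub>v w + b"
    unfolding u using mult_add_distrib_mat_vec[OF A w v] Av by simp
  then have "scalar_prod u (A *\<^sub>v u) = scalar_prod w (A *\<^sub>v w) + scalar_prod w b
      + (scalar_prod v (A *\<^sub>v w) + scalar_prod v b)"
    unfolding u using w v b Aw
    by (simp add: add_scalar_prod_distrib[of _ n] scalar_prod_add_distrib[of _ n])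
  also have "scalar_prod v (A *\<^sub>v w) = scalar_prod w b"
    unfolding symmetric_scalar_prod_swap[OF A sym v w] Av by (rule comm_scalar_prod[OF b w])
  finally show ?thesis using 1 by (simp add: b_def)
qed

text \<open>Block elimination: the matrix is a block lower triangular factor with identity diagonal
  times a block upper triangular one whose diagonal blocks are \<open>A\<close> and the Schur
  complement.\<close>

lemma schur_complement_det:
  fixes A :: "real mat"
  assumes A: "A \<in> carrier_mat n n" and inv: "invertible_mat A"
    and B: "B \<in> carrier_mat n m" and C: "C \<in> carrier_mat m n" and D: "D \<in> carrier_mat m m"
  shows "det (four_block_mat A B C D) = det A * det (D - C * minv A * B)"
proof -
  note I = minv_props[OF A inv]
  let ?S = "D - C * minv A * B"
  have S: "?S \<in> carrier_mat m m" and CI: "C * minv A \<in> carrier_mat m n" using B C I(1) by auto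
  have CA: "C * minv A * A = C" using C I A by simp
  have "four_block_mat (1\<^sub>m n) (0\<^sub>m n m) (C * minv A) (1\<^sub>m m) * four_block_mat A B (0\<^sub>m m n) ?S
      = four_block_mat (1\<^sub>m n * A + 0\<^sub>m n m * 0\<^sub>m m n) (1\<^sub>m n * B + 0\<^sub>m n m * ?S)
          (C * minv A * A + 1\<^sub>m m * 0\<^sub>m m n) (C * minv A * B + 1\<^sub>m m * ?S)"
    by (rule mult_four_block_mat[OF one_carrier_mat zero_carrier_mat CI one_carrier_mat A B zero_carrier_mat S])
  also have "\<dots> = four_block_mat A B C D"
  proof -
    have "C * minv A * B + ?S = D" using B CI D by (intro eq_matI) auto
    then show ?thesis using A B C S by (simp add: CA)
  qed
  finally have "det (four_block_mat A B C D) = det (four_block_mat (1\<^sub>m n) (0\<^sub>m n m) (C * minv A) (1\<^sub>m m))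
      * det (four_block_mat A B (0\<^sub>m m n) ?S)"
    using det_mult[of "four_block_mat (1\<^sub>m n) (0\<^sub>m n m) (C * minv A) (1\<^sub>m m)" "n + m"
        "four_block_mat A B (0\<^sub>m m n) ?S"] A S by simp
  also have "det (four_block_mat (1\<^sub>m n) (0\<^sub>m n m) (C * minv A) (1\<^sub>m m)) = 1"
    using det_four_block_mat_upper_right_zero[of "1\<^sub>m n" n "0\<^sub>m n m" m "C * minv A" "1\<^sub>m m"] CI by simp
  also have "det (four_block_mat A B (0\<^sub>m m n) ?S) = det A * det ?S"
    by (rule det_four_block_mat_lower_left_zero[OF A B refl S])
  finally show ?thesis by simp
qed

subsection \<open>Gram forms and the RKHS norm\<close>

text \<open>The squared RKHS norm of the expansion with coefficients \<open>c\<close> at the points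
  \<open>p i\<close>. The index type is arbitrary so that two families can be joined by a disjoint
  sum and points may repeat.\<close>

definition gram_form :: "('a \<Rightarrow> 'a \<Rightarrow> real) \<Rightarrow> 'i set \<Rightarrow> ('i \<Rightarrow> 'a) \<Rightarrow> ('i \<Rightarrow> real) \<Rightarrow> real" where
  "gram_form k I p c = (\<Sum>i\<in>I. \<Sum>j\<in>I. c i * c j * k (p i) (p j))"

text \<open>\<open>pd_kernel\<close> speaks of points indexed by an initial segment of the naturals;
  an enumeration of \<open>I\<close> transfers it to any finite index set.\<close>

lemma gram_form_nonneg:
  assumes pd: "pd_kernel X k" and fin: "finite I" and p: "p ` I \<subseteq> X"
  shows "0 \<le> gram_form k I p c"
proof -
  obtain h where h: "bij_betw h {..<card I} I"
    using ex_bij_betw_nat_finite[OF fin] by (auto simp: atLeast0LessThan)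
  have "gram_form k I p c = (\<Sum>i<card I. \<Sum>j<card I. c (h i) * c (h j) * k (p (h i)) (p (h j)))"
    unfolding gram_form_def by (simp add: sum.reindex_bij_betw[OF h, symmetric])
  moreover have "\<forall>i<card I. (p \<circ> h) i \<in> X" using h p by (auto simp: bij_betw_def)
  ultimately show ?thesis using pd unfolding pd_kernel_def by (auto simp: o_def)
qed

lemma nonneg_form_discriminant:
  fixes P M R :: real
  assumes "\<And>s t. 0 \<le> s\<^sup>2 * P + 2 * s * t * M + t\<^sup>2 * R"
  shows "M\<^sup>2 \<le> P * R"
proof (cases "R = 0")
  case True
  have "M = 0"
  proof (rule ccontr)
    assume "M \<noteq> 0"
    \<comment> \<open>With \<open>R = 0\<close> this choice of \<open>t\<close> gives the form the
      value -1.\<close>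
    then show False using assms[of 1 "- (P + 1) / (2 * M)"] True by (simp add: field_simps)
  qed
  then show ?thesis using True by simp
next
  case False
  then have "0 < R" using assms[of 0 1] by simp
  moreover have "0 \<le> R * (P * R - M\<^sup>2)"
    \<comment> \<open>At \<open>s = R\<close>, \<open>t = - M\<close> the form equals
      \<open>R * (P * R - M\<^sup>2)\<close>.\<close>
    using assms[of R "- M"] by (simp add: power2_eq_square algebra_simps)
  ultimately show ?thesis by (simp add: zero_le_mult_iff)
qed

text \<open>On the disjoint union of the two families, the coefficients \<open>s * a\<close> and
  \<open>t * b\<close> give a Gram form that is a nonnegative binary form in \<open>s\<close> and
  \<open>t\<close>. Its discriminant inequality is the claim; the Gram form may be
  degenerate.\<close>

lemma kernel_cauchy_schwarz:
  assumes pd: "pd_kernel X k" and fin: "finite I" "finite J" and p: "p ` I \<subseteq> X" and q: "q ` J \<subseteq> X"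
  shows "\<bar>\<Sum>i\<in>I. \<Sum>j\<in>J. a i * b j * k (p i) (q j)\<bar> \<le> sqrt (gram_form k I p a) * sqrt (gram_form k J q b)"
proof -
  define M where "M = (\<Sum>i\<in>I. \<Sum>j\<in>J. a i * b j * k (p i) (q j))"
  have M': "(\<Sum>j\<in>J. \<Sum>i\<in>I. b j * a i * k (q j) (p i)) = M"
    unfolding M_def using pd p q
    by (subst sum.swap, intro sum.cong refl) (auto simp: pd_kernel_def image_subset_iff)
  have "0 \<le> s\<^sup>2 * gram_form k I p a + 2 * s * t * M + t\<^sup>2 * gram_form k J q b" for s t
  proof -
    have "0 \<le> gram_form k (I <+> J) (case_sum p q) (case_sum (\<lambda>i. s * a i) (\<lambda>j. t * b j))"
      by (rule gram_form_nonneg[OF pd]) (use fin p q in \<open>auto simp: image_subset_iff\<close>)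
    also have "\<dots> = s\<^sup>2 * gram_form k I p a + s * t * M + (s * t * (\<Sum>j\<in>J. \<Sum>i\<in>I. b j * a i * k (q j) (p i)) + t\<^sup>2 * gram_form k J q b)"
      using fin unfolding gram_form_def M_def
      by (simp add: sum.Plus o_def sum.distrib sum_distrib_left power2_eq_square mult_ac)
    finally show ?thesis unfolding M' by (simp add: algebra_simps)
  qed
  then have "M\<^sup>2 \<le> gram_form k I p a * gram_form k J q b" by (rule nonneg_form_discriminant)
  then have "\<bar>M\<bar> \<le> sqrt (gram_form k I p a * gram_form k J q b)"
    by (metis real_sqrt_abs real_sqrt_le_iff)
  then show ?thesis by (simp add: M_def real_sqrt_mult)
qed

lemma gram_form_triangle:
  assumes pd: "pd_kernel X k" and fin: "finite I" and p: "p ` I \<subseteq> X"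
  shows "sqrt (gram_form k I p (\<lambda>i. a i + b i)) \<le> sqrt (gram_form k I p a) + sqrt (gram_form k I p b)"
proof -
  define M where "M = (\<Sum>i\<in>I. \<Sum>j\<in>I. a i * b j * k (p i) (p j))"
  have M': "(\<Sum>i\<in>I. \<Sum>j\<in>I. b i * a j * k (p i) (p j)) = M"
    unfolding M_def using pd p
    by (subst sum.swap, intro sum.cong refl) (auto simp: pd_kernel_def image_subset_iff)
  note nn = gram_form_nonneg[OF pd fin p]
  have "gram_form k I p (\<lambda>i. a i + b i) = gram_form k I p a + M + ((\<Sum>i\<in>I. \<Sum>j\<in>I. b i * a j * k (p i) (p j)) + gram_form k I p b)"
    unfolding gram_form_def M_def by (simp add: sum.distrib algebra_simps)
  also have "\<dots> = gram_form k I p a + 2 * M + gram_form k I p b" unfolding M' by simp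
  also have "\<dots> \<le> gram_form k I p a + 2 * (sqrt (gram_form k I p a) * sqrt (gram_form k I p b)) + gram_form k I p b"
    using kernel_cauchy_schwarz[OF pd fin fin p p, of a b] by (simp add: M_def abs_le_iff)
  also have "\<dots> = (sqrt (gram_form k I p a) + sqrt (gram_form k I p b))\<^sup>2"
    using nn by (simp add: power2_sum)
  finally show ?thesis using nn by (intro real_le_lsqrt) auto
qed

section \<open>From finite kernel expansions to the RKHS norm\<close>

lemma kspan_sqnorm_gram_form:
  assumes "finite S" "{y. c y \<noteq> 0} \<subseteq> S"
  shows "kspan_sqnorm k c = gram_form k S (\<lambda>y. y) c"
proof -
  have "(\<Sum>z\<in>{y. c y \<noteq> 0}. c y * c z * k y z) = (\<Sum>z\<in>S. c y * c z * k y z)" for y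
    using assms by (intro sum.mono_neutral_left) auto
  moreover have "(\<Sum>y\<in>{y. c y \<noteq> 0}. \<Sum>z\<in>S. c y * c z * k y z) = (\<Sum>y\<in>S. \<Sum>z\<in>S. c y * c z * k y z)"
    using assms by (intro sum.mono_neutral_left) auto
  ultimately show ?thesis by (simp add: kspan_sqnorm_def gram_form_def)
qed

text \<open>The reverse triangle inequality. All three norms are first written over the union
  \<open>S\<close> of the supports, where the added coefficients vanish and the triangle inequality
  for one Gram form applies.\<close>

lemma kspan_norm_diff:
  assumes pd: "pd_kernel X k" and c: "fin_coeffs X c" and d: "fin_coeffs X d"
  shows "\<bar>sqrt (kspan_sqnorm k c) - sqrt (kspan_sqnorm k d)\<bar> \<le> sqrt (kspan_sqnorm k (\<lambda>y. c y - d y))"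
proof -
  define S where "S = {y. c y \<noteq> 0} \<union> {y. d y \<noteq> 0}"
  have S: "finite S" "(\<lambda>y. y) ` S \<subseteq> X" using c d by (auto simp: S_def fin_coeffs_def)
  let ?N = "\<lambda>c. sqrt (gram_form k S (\<lambda>y. y) c)"
  have "?N (\<lambda>y. d y + (c y - d y)) \<le> ?N d + ?N (\<lambda>y. c y - d y)"
    by (rule gram_form_triangle[OF pd S])
  moreover have "?N (\<lambda>y. c y + (d y - c y)) \<le> ?N c + ?N (\<lambda>y. d y - c y)"
    by (rule gram_form_triangle[OF pd S])
  moreover have "gram_form k S (\<lambda>y. y) (\<lambda>y. d y - c y) = gram_form k S (\<lambda>y. y) (\<lambda>y. c y - d y)"
    unfolding gram_form_def by (intro sum.cong refl) (simp add: algebra_simps)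
  moreover have "kspan_sqnorm k c = gram_form k S (\<lambda>y. y) c" "kspan_sqnorm k d = gram_form k S (\<lambda>y. y) d"
    "kspan_sqnorm k (\<lambda>y. c y - d y) = gram_form k S (\<lambda>y. y) (\<lambda>y. c y - d y)"
    by (rule kspan_sqnorm_gram_form[OF S(1)]; auto simp: S_def)+
  ultimately show ?thesis by simp
qed

lemma approx_seq_norms_converge:
  assumes pd: "pd_kernel X k" and cs: "approx_seq k X f cs"
  shows "convergent (\<lambda>n. sqrt (kspan_sqnorm k (cs n)))"
proof (rule Cauchy_convergent, rule CauchyI)
  fix e :: real assume e: "0 < e"
  \<comment> \<open>The Cauchy condition of \<open>approx_seq\<close> concerns squared norms, hence
    the tolerance \<open>e\<^sup>2\<close>.\<close>
  then obtain N where N: "\<And>m n. m \<ge> N \<Longrightarrow> n \<ge> N \<Longrightarrow> kspan_sqnorm k (\<lambda>y. cs m y - cs n y) < e\<^sup>2"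
    using cs unfolding approx_seq_def by (meson zero_less_power)
  have "norm (sqrt (kspan_sqnorm k (cs m)) - sqrt (kspan_sqnorm k (cs n))) < e" if "m \<ge> N" "n \<ge> N" for m n
  proof -
    have "\<bar>sqrt (kspan_sqnorm k (cs m)) - sqrt (kspan_sqnorm k (cs n))\<bar>
        \<le> sqrt (kspan_sqnorm k (\<lambda>y. cs m y - cs n y))"
      by (rule kspan_norm_diff[OF pd]) (use cs in \<open>auto simp: approx_seq_def\<close>)
    also have "\<dots> < e" using N[OF that] e by (simp add: real_less_lsqrt)
    finally show ?thesis by simp
  qed
  then show "\<exists>M. \<forall>m\<ge>M. \<forall>n\<ge>M. norm (sqrt (kspan_sqnorm k (cs m)) - sqrt (kspan_sqnorm k (cs n))) < e" by blast
qed

text \<open>For each approximant the inequality is Cauchy--Schwarz between the weighted points and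
  the kernel expansion. Pointwise convergence on the left and convergence of norms on the right
  carry it to the limit.\<close>

lemma approx_seq_functional_bound:
  assumes pd: "pd_kernel X k" and cs: "approx_seq k X f cs"
    and l: "(\<lambda>n. sqrt (kspan_sqnorm k (cs n))) \<longlonglongrightarrow> l"
    and fin: "finite I" and p: "p ` I \<subseteq> X"
  shows "\<bar>\<Sum>i\<in>I. a i * f (p i)\<bar> \<le> l * sqrt (gram_form k I p a)"
proof (rule tendsto_le[OF sequentially_bot])
  show "(\<lambda>n. sqrt (kspan_sqnorm k (cs n)) * sqrt (gram_form k I p a)) \<longlonglongrightarrow> l * sqrt (gram_form k I p a)"
    by (intro tendsto_intros l)
  show "(\<lambda>n. \<bar>\<Sum>i\<in>I. a i * kspan_fun k (cs n) (p i)\<bar>) \<longlonglongrightarrow> \<bar>\<Sum>i\<in>I. a i * f (p i)\<bar>"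
    using cs p by (intro tendsto_intros) (auto simp: approx_seq_def)
  have "\<bar>\<Sum>i\<in>I. a i * kspan_fun k (cs n) (p i)\<bar> \<le> sqrt (kspan_sqnorm k (cs n)) * sqrt (gram_form k I p a)" for n
  proof -
    let ?S = "{y. cs n y \<noteq> 0}"
    have S: "finite ?S" "(\<lambda>y. y) ` ?S \<subseteq> X" using cs by (auto simp: approx_seq_def fin_coeffs_def)
    have "(\<Sum>i\<in>I. a i * kspan_fun k (cs n) (p i)) = (\<Sum>i\<in>I. \<Sum>y\<in>?S. a i * cs n y * k (p i) y)"
      by (simp add: kspan_fun_def sum_distrib_left mult.assoc)
    also have "\<bar>\<dots>\<bar> \<le> sqrt (gram_form k I p a) * sqrt (gram_form k ?S (\<lambda>y. y) (cs n))"
      by (rule kernel_cauchy_schwarz[OF pd fin S(1) p S(2)])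
    also have "gram_form k ?S (\<lambda>y. y) (cs n) = kspan_sqnorm k (cs n)"
      by (simp add: kspan_sqnorm_gram_form[OF S(1)])
    finally show ?thesis by (simp add: mult.commute)
  qed
  then show "\<forall>\<^sub>F n in sequentially. \<bar>\<Sum>i\<in>I. a i * kspan_fun k (cs n) (p i)\<bar>
      \<le> sqrt (kspan_sqnorm k (cs n)) * sqrt (gram_form k I p a)" by simp
qed

lemma rkhs_norm_set_nonempty:
  assumes "pd_kernel X k" "in_rkhs k X f"
  shows "{l. \<exists>cs. approx_seq k X f cs \<and> (\<lambda>n. sqrt (kspan_sqnorm k (cs n))) \<longlonglongrightarrow> l} \<noteq> {}"
proof -
  obtain cs where cs: "approx_seq k X f cs" using assms(2) by (auto simp: in_rkhs_def)
  then obtain l where "(\<lambda>n. sqrt (kspan_sqnorm k (cs n))) \<longlonglongrightarrow> l"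
    using approx_seq_norms_converge[OF assms(1)] by (auto simp: convergent_def)
  with cs show ?thesis by blast
qed

lemma rkhs_norm_nonneg:
  assumes pd: "pd_kernel X k" and f: "in_rkhs k X f"
  shows "0 \<le> rkhs_norm k X f"
  unfolding rkhs_norm_def
proof (rule cInf_greatest[OF rkhs_norm_set_nonempty[OF assms]])
  fix l assume "l \<in> {l. \<exists>cs. approx_seq k X f cs \<and> (\<lambda>n. sqrt (kspan_sqnorm k (cs n))) \<longlonglongrightarrow> l}"
  then obtain cs where cs: "approx_seq k X f cs" and l: "(\<lambda>n. sqrt (kspan_sqnorm k (cs n))) \<longlonglongrightarrow> l" by blast
  have "0 \<le> sqrt (kspan_sqnorm k (cs n))" for n
  proof -
    have S: "finite {y. cs n y \<noteq> 0}" "(\<lambda>y. y) ` {y. cs n y \<noteq> 0} \<subseteq> X"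
      using cs by (auto simp: approx_seq_def fin_coeffs_def)
    show ?thesis using gram_form_nonneg[OF pd S] by (simp add: kspan_sqnorm_gram_form[OF S(1)])
  qed
  then show "0 \<le> l" using LIMSEQ_le_const[OF l] by blast
qed

lemma rkhs_functional_bound:
  assumes pd: "pd_kernel X k" and f: "in_rkhs k X f"
    and fin: "finite I" and p: "p ` I \<subseteq> X"
  shows "\<bar>\<Sum>i\<in>I. a i * f (p i)\<bar> \<le> rkhs_norm k X f * sqrt (gram_form k I p a)"
proof -
  let ?S = "{l. \<exists>cs. approx_seq k X f cs \<and> (\<lambda>n. sqrt (kspan_sqnorm k (cs n))) \<longlonglongrightarrow> l}"
  let ?q = "sqrt (gram_form k I p a)"
  have bound: "\<bar>\<Sum>i\<in>I. a i * f (p i)\<bar> \<le> l * ?q" if "l \<in> ?S" for l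
    using that approx_seq_functional_bound[OF pd _ _ fin p] by blast
  have ne: "?S \<noteq> {}" by (rule rkhs_norm_set_nonempty[OF pd f])
  show ?thesis
  proof (cases "?q = 0")
    case True
    obtain l where "l \<in> ?S" using ne by blast
    from bound[OF this] show ?thesis unfolding True by simp
  next
    case False
    then have q: "0 < ?q" using gram_form_nonneg[OF pd fin p, of a] by simp
    have "\<bar>\<Sum>i\<in>I. a i * f (p i)\<bar> / ?q \<le> Inf ?S"
      by (rule cInf_greatest[OF ne]) (use bound q in \<open>simp add: pos_divide_le_eq\<close>)
    then show ?thesis using q by (simp add: rkhs_norm_def pos_divide_le_eq)
  qed
qed

subsection \<open>Posterior mean and covariance\<close>

lemma scalar_prod_mult_mat_vec:
  assumes "A \<in> carrier_mat n m" "w \<in> carrier_vec n" "a \<in> carrier_vec m"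
  shows "scalar_prod w (A *\<^sub>v a) = (\<Sum>i<n. \<Sum>j<m. vec_index w i * A $$ (i, j) * vec_index a j)"
proof -
  have "scalar_prod w (A *\<^sub>v a) = (\<Sum>i<n. vec_index w i * (\<Sum>j<m. A $$ (i, j) * vec_index a j))"
    using assms by (auto simp: scalar_prod_def atLeast0LessThan intro!: sum.cong)
  then show ?thesis by (simp add: sum_distrib_left mult.assoc)
qed

lemma mtrace_mono:
  assumes A: "A \<in> carrier_mat n n" and B: "B \<in> carrier_mat n n"
    and le: "\<And>a. a \<in> carrier_vec n \<Longrightarrow> scalar_prod a (A *\<^sub>v a) \<le> scalar_prod a (B *\<^sub>v a)"
  shows "mtrace A \<le> mtrace B"
proof -
  have e: "scalar_prod (unit_vec n i) (M *\<^sub>v unit_vec n i) = M $$ (i, i)"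
    if "M \<in> carrier_mat n n" "i < n" for M :: "real mat" and i
    using that by simp
  have "A $$ (i, i) \<le> B $$ (i, i)" if "i < n" for i
    using le[of "unit_vec n i"] e[OF A that] e[OF B that] by simp
  then show ?thesis using A B by (auto simp: mtrace_def intro!: sum_mono)
qed

lemma scaled_one_plus:
  fixes M :: "real mat"
  assumes "M \<in> carrier_mat n n" "s \<noteq> 0"
  shows "s \<cdot>\<^sub>m 1\<^sub>m n + M = s \<cdot>\<^sub>m (1\<^sub>m n + (1 / s) \<cdot>\<^sub>m M)"
  using assms by (intro eq_matI) (auto simp: field_simps)

lemma det_scaled_one_plus:
  fixes M :: "real mat"
  assumes "M \<in> carrier_mat n n" "s \<noteq> 0"
  shows "det (s \<cdot>\<^sub>m 1\<^sub>m n + M) = s ^ n * det (1\<^sub>m n + (1 / s) \<cdot>\<^sub>m M)"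
  using assms by (simp add: scaled_one_plus)

section \<open>Conditioning an \<open>L\<close>-tuple on the first \<open>t\<close> queried
  points\<close>

locale kernel_tuple =
  fixes X :: "'a set" and k :: "'a \<Rightarrow> 'a \<Rightarrow> real" and xs :: "nat \<Rightarrow> 'a" and t L :: nat and z :: "nat \<Rightarrow> 'a"
  assumes pd: "pd_kernel X k"
    and xs_in: "\<And>i. i < t \<Longrightarrow> xs (Suc i) \<in> X"
    and z_in: "\<And>j. j < L \<Longrightarrow> z j \<in> X"
begin

abbreviation "K \<equiv> Kmat k xs t"
abbreviation "B \<equiv> cross_mat k xs t L z"
abbreviation "D \<equiv> tuple_mat k L z"
text \<open>The quadratic form of the block matrix with blocks \<open>K\<close>, \<open>B\<close>,
  its transpose and \<open>D\<close> at \<open>(w, a)\<close>. Written as a Gram form of queried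
  points and tuple together, it is nonnegative because the kernel is positive definite.\<close>

abbreviation "joint w a \<equiv> gram_form k ({..<t} <+> {..<L}) (case_sum (\<lambda>i. xs (Suc i)) z)
  (case_sum (vec_index w) (vec_index a))"

lemma kernel_sym: "x \<in> X \<Longrightarrow> y \<in> X \<Longrightarrow> k x y = k y x"
  using pd by (simp add: pd_kernel_def)

lemma carriers: "K \<in> carrier_mat t t" "B \<in> carrier_mat t L" "D \<in> carrier_mat L L"
  by (auto simp: Kmat_def cross_mat_def tuple_mat_def)

lemma joint_nonneg: "0 \<le> joint w a"
  by (rule gram_form_nonneg[OF pd]) (use xs_in z_in in \<open>auto simp: image_subset_iff\<close>)

lemma joint_eq:
  assumes w: "w \<in> carrier_vec t" and a: "a \<in> carrier_vec L"
  shows "joint w a = scalar_prod w (K *\<^sub>v w) + 2 * scalar_prod w (B *\<^sub>v a) + scalar_prod a (D *\<^sub>v a)"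
proof -
  have K: "scalar_prod w (K *\<^sub>v w) = (\<Sum>i<t. \<Sum>j<t. vec_index w i * vec_index w j * k (xs (Suc i)) (xs (Suc j)))"
    unfolding scalar_prod_mult_mat_vec[OF carriers(1) w w]
    by (intro sum.cong refl) (simp add: Kmat_def)
  have D: "scalar_prod a (D *\<^sub>v a) = (\<Sum>i<L. \<Sum>j<L. vec_index a i * vec_index a j * k (z i) (z j))"
    unfolding scalar_prod_mult_mat_vec[OF carriers(3) a a]
    by (intro sum.cong refl) (simp add: tuple_mat_def)
  have B: "scalar_prod w (B *\<^sub>v a) = (\<Sum>i<t. \<Sum>j<L. vec_index w i * vec_index a j * k (xs (Suc i)) (z j))"
    unfolding scalar_prod_mult_mat_vec[OF carriers(2) w a]
    by (intro sum.cong refl) (simp add: cross_mat_def)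
  have B': "(\<Sum>j<L. \<Sum>i<t. vec_index a j * vec_index w i * k (z j) (xs (Suc i))) = scalar_prod w (B *\<^sub>v a)"
    unfolding B by (subst sum.swap, intro sum.cong refl) (auto simp: kernel_sym xs_in z_in)
  have "joint w a = (scalar_prod w (K *\<^sub>v w) + scalar_prod w (B *\<^sub>v a))
      + ((\<Sum>j<L. \<Sum>i<t. vec_index a j * vec_index w i * k (z j) (xs (Suc i))) + scalar_prod a (D *\<^sub>v a))"
    unfolding gram_form_def K D B by (simp add: sum.Plus o_def sum.distrib)
  then show ?thesis unfolding B' by simp
qed

lemma psd_Kmat: "psd_mat K"
  unfolding psd_mat_def
proof (intro conjI ballI)
  show "transpose_mat K = K"
    by (intro eq_matI) (auto simp: Kmat_def kernel_sym xs_in)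
  fix w :: "real vec" assume "w \<in> carrier_vec (dim_col K)"
  then have w: "w \<in> carrier_vec t" by (simp add: Kmat_def)
  have "joint w (0\<^sub>v L) = scalar_prod w (K *\<^sub>v w)"
    using w carriers by (simp add: joint_eq scalar_prod_mult_mat_vec)
  then show "0 \<le> scalar_prod w (K *\<^sub>v w)" using joint_nonneg by metis
qed

lemma Kmat_form_nonneg: "w \<in> carrier_vec t \<Longrightarrow> 0 \<le> scalar_prod w (K *\<^sub>v w)"
  using psd_Kmat carriers by (auto simp: psd_mat_def)

lemma post_cov_carrier: "post_cov k xs t L z \<in> carrier_mat L L" "post_cov_noisy k \<sigma> xs t L z \<in> carrier_mat L L"
  using carriers by (auto simp: post_cov_def post_cov_noisy_def)

text \<open>By completing the square, the posterior covariance form at \<open>a\<close> is the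
  minimum of \<open>joint w a\<close> over \<open>w\<close>. The first claim names a minimiser, the
  second states minimality.\<close>

lemma post_cov_joint:
  assumes inv: "invertible_mat K" and a: "a \<in> carrier_vec L"
  shows "scalar_prod a (post_cov k xs t L z *\<^sub>v a) = joint (- (minv K *\<^sub>v (B *\<^sub>v a))) a"
    and "w \<in> carrier_vec t \<Longrightarrow> scalar_prod a (post_cov k xs t L z *\<^sub>v a) \<le> joint w a"
proof -
  have sym: "transpose_mat K = K" using psd_Kmat by (simp add: psd_mat_def)
  define v where "v = minv K *\<^sub>v (B *\<^sub>v a)"
  have v: "v \<in> carrier_vec t"
    using a unfolding v_def
    by (intro mult_mat_vec_carrier[OF minv_props(1)[OF carriers(1) inv]] mult_mat_vec_carrier[OF carriers(2)])
  have main: "joint w a = scalar_prod a (post_cov k xs t L z *\<^sub>v a) + scalar_prod (w + v) (K *\<^sub>v (w + v))"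
    if w: "w \<in> carrier_vec t" for w
    using schur_complement_quadratic_form[OF carriers(1) inv sym carriers(2,3) a w]
    unfolding joint_eq[OF w a] post_cov_def v_def by simp
  show "scalar_prod a (post_cov k xs t L z *\<^sub>v a) = joint (- (minv K *\<^sub>v (B *\<^sub>v a))) a"
    using main[of "- v"] v scalar_prod_mult_mat_vec[OF carriers(1), of "0\<^sub>v t" "0\<^sub>v t"]
    unfolding v_def[symmetric] by simp
  show "scalar_prod a (post_cov k xs t L z *\<^sub>v a) \<le> joint w a" if "w \<in> carrier_vec t"
    using main[OF that] Kmat_form_nonneg[of "w + v"] that v by simp
qed

lemma noisy_Kmat:
  assumes s: "0 < s"
  shows "s \<cdot>\<^sub>m 1\<^sub>m t + K \<in> carrier_mat t t" "transpose_mat (s \<cdot>\<^sub>m 1\<^sub>m t + K) = s \<cdot>\<^sub>m 1\<^sub>m t + K"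
    "0 < det (s \<cdot>\<^sub>m 1\<^sub>m t + K)" "invertible_mat (s \<cdot>\<^sub>m 1\<^sub>m t + K)"
proof -
  show car: "s \<cdot>\<^sub>m 1\<^sub>m t + K \<in> carrier_mat t t" using carriers by simp
  have "transpose_mat K = K" using psd_Kmat by (simp add: psd_mat_def)
  then show "transpose_mat (s \<cdot>\<^sub>m 1\<^sub>m t + K) = s \<cdot>\<^sub>m 1\<^sub>m t + K"
    using carriers by (subst transpose_add[of _ t t]) (auto intro!: eq_matI)
  show "0 < det (s \<cdot>\<^sub>m 1\<^sub>m t + K)"
    using det_scaled_one_plus[OF carriers(1), of s] psd_mat_det_pos[OF carriers(1) psd_Kmat, of "1 / s"] s by simp
  then show "invertible_mat (s \<cdot>\<^sub>m 1\<^sub>m t + K)" by (intro invertible_mat_det[OF car]) simp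
qed

text \<open>The same completion of the square with \<open>K\<close> shifted by the noise, evaluated
  at its minimiser \<open>- v\<close>, where the square vanishes. Splitting off the shift leaves a
  nonnegative penalty plus the noiseless \<open>joint\<close> form, which can be compared with the
  noiseless minimum.\<close>

lemma noisy_joint:
  assumes \<sigma>: "0 < \<sigma>" and a: "a \<in> carrier_vec L"
  obtains w where "w \<in> carrier_vec t"
    and "scalar_prod a (post_cov_noisy k \<sigma> xs t L z *\<^sub>v a) = \<sigma>\<^sup>2 * scalar_prod w w + joint w a"
proof -
  let ?N = "\<sigma>\<^sup>2 \<cdot>\<^sub>m 1\<^sub>m t + K"
  have s: "0 < \<sigma>\<^sup>2" using \<sigma> by simp
  note N = noisy_Kmat[OF s]
  define v where "v = minv ?N *\<^sub>v (B *\<^sub>v a)"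
  have v: "v \<in> carrier_vec t"
    using a unfolding v_def by (intro mult_mat_vec_carrier[OF minv_props(1)[OF N(1,4)]] mult_mat_vec_carrier[OF carriers(2)])
  then have mv: "- v \<in> carrier_vec t" by simp
  have Nv: "?N *\<^sub>v (- v) = \<sigma>\<^sup>2 \<cdot>\<^sub>v (- v) + K *\<^sub>v (- v)"
    using mv carriers by (subst add_mult_distrib_mat_vec[of _ t t]) (auto intro!: eq_vecI)
  have "scalar_prod (- v) (?N *\<^sub>v (- v)) + 2 * scalar_prod (- v) (B *\<^sub>v a) + scalar_prod a (D *\<^sub>v a)
      = scalar_prod a (post_cov_noisy k \<sigma> xs t L z *\<^sub>v a) + scalar_prod (- v + v) (?N *\<^sub>v (- v + v))"
    using schur_complement_quadratic_form[OF N(1,4,2) carriers(2,3) a mv]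
    unfolding post_cov_noisy_def v_def by simp
  also have "- v + v = 0\<^sub>v t" using v by auto
  also have "scalar_prod (- v) (?N *\<^sub>v (- v)) = \<sigma>\<^sup>2 * scalar_prod (- v) (- v) + scalar_prod (- v) (K *\<^sub>v (- v))"
    unfolding Nv using mv carriers by (subst scalar_prod_add_distrib[of _ t]) auto
  finally have "scalar_prod a (post_cov_noisy k \<sigma> xs t L z *\<^sub>v a) = \<sigma>\<^sup>2 * scalar_prod (- v) (- v) + joint (- v) a"
    using N(1) by (simp add: joint_eq[OF mv a])
  with mv show thesis by (rule that)
qed

lemma psd_post_cov_noisy:
  assumes \<sigma>: "0 < \<sigma>"
  shows "psd_mat (post_cov_noisy k \<sigma> xs t L z)"
  unfolding psd_mat_def
proof (intro conjI ballI)
  let ?N = "\<sigma>\<^sup>2 \<cdot>\<^sub>m 1\<^sub>m t + K"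
  have s: "0 < \<sigma>\<^sup>2" using \<sigma> by simp
  note N = noisy_Kmat[OF s]
  have I: "minv ?N \<in> carrier_mat t t" by (rule minv_props[OF N(1,4)])
  have BI: "transpose_mat B * minv ?N \<in> carrier_mat L t" using carriers I by simp
  have "transpose_mat (transpose_mat B * minv ?N * B) = transpose_mat B * (minv ?N * B)"
    using carriers I BI by (simp only: transpose_mult[OF BI carriers(2)] transpose_mult[of _ L t _ t]
      minv_symmetric[OF N(1,4,2)] transpose_transpose transpose_carrier_mat)
  also have "\<dots> = transpose_mat B * minv ?N * B"
    using carriers I by (intro assoc_mult_mat[symmetric]) auto
  finally have "transpose_mat (transpose_mat B * minv ?N * B) = transpose_mat B * minv ?N * B" .
  moreover have "transpose_mat D = D"
    by (intro eq_matI) (auto simp: tuple_mat_def kernel_sym z_in)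
  ultimately show "transpose_mat (post_cov_noisy k \<sigma> xs t L z) = post_cov_noisy k \<sigma> xs t L z"
    unfolding post_cov_noisy_def using transpose_minus[OF carriers(3) mult_carrier_mat[OF BI carriers(2)]] by simp
  fix a :: "real vec" assume "a \<in> carrier_vec (dim_col (post_cov_noisy k \<sigma> xs t L z))"
  then have a: "a \<in> carrier_vec L" using post_cov_carrier(2)[of \<sigma>] by auto
  obtain w where "scalar_prod a (post_cov_noisy k \<sigma> xs t L z *\<^sub>v a) = \<sigma>\<^sup>2 * scalar_prod w w + joint w a"
    using noisy_joint[OF \<sigma> a] by metis
  then show "0 \<le> scalar_prod a (post_cov_noisy k \<sigma> xs t L z *\<^sub>v a)"
    using joint_nonneg[of w a] by (simp add: scalar_prod_self)
qed

text \<open>The weights from the noisy problem compete in the noiseless minimisation, and the noise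
  penalty is nonnegative. The forms are therefore ordered, and so are the traces.\<close>

lemma mtrace_post_cov_le_noisy:
  assumes inv: "invertible_mat K" and \<sigma>: "0 < \<sigma>"
  shows "mtrace (post_cov k xs t L z) \<le> mtrace (post_cov_noisy k \<sigma> xs t L z)"
proof (rule mtrace_mono[OF post_cov_carrier])
  fix a :: "real vec" assume a: "a \<in> carrier_vec L"
  obtain w where w: "w \<in> carrier_vec t"
    and eq: "scalar_prod a (post_cov_noisy k \<sigma> xs t L z *\<^sub>v a) = \<sigma>\<^sup>2 * scalar_prod w w + joint w a"
    using noisy_joint[OF \<sigma> a] by metis
  show "scalar_prod a (post_cov k xs t L z *\<^sub>v a) \<le> scalar_prod a (post_cov_noisy k \<sigma> xs t L z *\<^sub>v a)"
    unfolding eq using post_cov_joint(2)[OF inv a w] by (simp add: scalar_prod_self add_increasing)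
qed

text \<open>The weighted error is a combination of values of \<open>f\<close> with weights
  \<open>a\<close> on the tuple and \<open>- v\<close> on the queried points. These are the
  minimising weights, so the Gram form in \<open>rkhs_functional_bound\<close> is exactly the
  posterior covariance form.\<close>

lemma post_mean_error:
  assumes inv: "invertible_mat K" and f: "in_rkhs k X f" and a: "a \<in> carrier_vec L"
  shows "\<bar>\<Sum>j<L. vec_index a j * (f (z j) - post_mean k xs f t (z j))\<bar>
    \<le> rkhs_norm k X f * sqrt (scalar_prod a (post_cov k xs t L z *\<^sub>v a))"
proof -
  define F where "F = Matrix.vec t (\<lambda>i. f (xs (Suc i)))"
  define v where "v = minv K *\<^sub>v (B *\<^sub>v a)"
  have sym: "transpose_mat K = K" using psd_Kmat by (simp add: psd_mat_def)
  note I = minv_props(1)[OF carriers(1) inv]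
  have F: "F \<in> carrier_vec t" by (simp add: F_def)
  have Ba: "B *\<^sub>v a \<in> carrier_vec t" by (rule mult_mat_vec_carrier[OF carriers(2) a])
  have v: "v \<in> carrier_vec t" unfolding v_def by (rule mult_mat_vec_carrier[OF I Ba])
  have IF: "minv K *\<^sub>v F \<in> carrier_vec t" by (rule mult_mat_vec_carrier[OF I F])
  have pm: "post_mean k xs f t (z j) = (\<Sum>i<t. k (xs (Suc i)) (z j) * vec_index (minv K *\<^sub>v F) i)" if "j < L" for j
    unfolding post_mean_def F_def[symmetric] scalar_prod_def carrier_vecD[OF IF] atLeast0LessThan
    by (intro sum.cong refl) (simp add: kernel_sym xs_in z_in that)
  have "(\<Sum>j<L. vec_index a j * post_mean k xs f t (z j))
      = (\<Sum>i<t. \<Sum>j<L. vec_index (minv K *\<^sub>v F) i * B $$ (i, j) * vec_index a j)"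
    by (subst sum.swap, intro sum.cong refl)
      (simp add: pm sum_distrib_left cross_mat_def mult_ac)
  also have "\<dots> = scalar_prod (minv K *\<^sub>v F) (B *\<^sub>v a)"
    by (rule scalar_prod_mult_mat_vec[OF carriers(2) IF a, symmetric])
  \<comment> \<open>Symmetry of the inverse moves it from the observations onto \<open>B a\<close>,
    which exposes the weight \<open>v\<close> of each observed value.\<close>
  also have "\<dots> = scalar_prod F v"
    unfolding v_def
    by (rule symmetric_scalar_prod_swap[OF I minv_symmetric[OF carriers(1) inv sym] F Ba, symmetric])
  also have "\<dots> = (\<Sum>i<t. vec_index v i * f (xs (Suc i)))"
    using v by (auto simp: scalar_prod_def F_def atLeast0LessThan intro!: sum.cong)
  finally have mean: "(\<Sum>j<L. vec_index a j * post_mean k xs f t (z j)) = (\<Sum>i<t. vec_index v i * f (xs (Suc i)))" .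
  have "(\<Sum>j<L. vec_index a j * (f (z j) - post_mean k xs f t (z j)))
      = (\<Sum>i\<in>{..<t} <+> {..<L}. case_sum (vec_index (- v)) (vec_index a) i * f (case_sum (\<lambda>i. xs (Suc i)) z i))"
    using v by (simp add: sum.Plus o_def right_diff_distrib sum_subtractf mean sum_negf)
  also have "\<bar>\<dots>\<bar> \<le> rkhs_norm k X f * sqrt (joint (- v) a)"
    by (rule rkhs_functional_bound[OF pd f]) (use xs_in z_in in \<open>auto simp: image_subset_iff\<close>)
  also have "joint (- v) a = scalar_prod a (post_cov k xs t L z *\<^sub>v a)"
    unfolding v_def by (rule post_cov_joint(1)[OF inv a, symmetric])
  finally show ?thesis .
qed

text \<open>Multiplied by \<open>\<sigma>\<^sup>2\<close>, the enlarged matrix has the old noisy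
  matrix as its upper left block, and the Schur complement of that block is the noisy posterior
  covariance plus \<open>\<sigma>\<^sup>2\<close> times the identity. The powers of
  \<open>\<sigma>\<^sup>2\<close> cancel since the dimensions add up.\<close>

lemma det_Kmat_append:
  assumes \<sigma>: "0 < \<sigma>" and z: "\<And>j. j < L \<Longrightarrow> z j = xs (Suc (t + j))"
  shows "det (1\<^sub>m (t + L) + (1 / \<sigma>\<^sup>2) \<cdot>\<^sub>m Kmat k xs (t + L))
    = det (1\<^sub>m t + (1 / \<sigma>\<^sup>2) \<cdot>\<^sub>m K) * det (1\<^sub>m L + (1 / \<sigma>\<^sup>2) \<cdot>\<^sub>m post_cov_noisy k \<sigma> xs t L z)"
proof -
  have s: "0 < \<sigma>\<^sup>2" using \<sigma> by simp
  then have s0: "\<sigma>\<^sup>2 \<noteq> 0" by simp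
  let ?N = "\<sigma>\<^sup>2 \<cdot>\<^sub>m 1\<^sub>m t + K"
  let ?D = "\<sigma>\<^sup>2 \<cdot>\<^sub>m 1\<^sub>m L + D"
  note N = noisy_Kmat[OF s]
  have D: "?D \<in> carrier_mat L L" using carriers by simp
  have I: "minv ?N \<in> carrier_mat t t" by (rule minv_props[OF N(1,4)])
  have BIB: "transpose_mat B * minv ?N * B \<in> carrier_mat L L" using carriers I by simp
  have KT: "Kmat k xs (t + L) \<in> carrier_mat (t + L) (t + L)" by (simp add: Kmat_def)
  have block: "\<sigma>\<^sup>2 \<cdot>\<^sub>m 1\<^sub>m (t + L) + Kmat k xs (t + L) = four_block_mat ?N B (transpose_mat B) ?D"
  proof (rule eq_matI)
    fix i j assume "i < dim_row (four_block_mat ?N B (transpose_mat B) ?D)" "j < dim_col (four_block_mat ?N B (transpose_mat B) ?D)"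
    then have ij: "i < t + L" "j < t + L" using carriers by auto
    have zi: "xs (Suc i) = z (i - t)" if "\<not> i < t" "i < t + L" for i
      using z[of "i - t"] that by simp
    show "(\<sigma>\<^sup>2 \<cdot>\<^sub>m 1\<^sub>m (t + L) + Kmat k xs (t + L)) $$ (i, j) = four_block_mat ?N B (transpose_mat B) ?D $$ (i, j)"
      using ij by (auto simp: four_block_mat_def Let_def Kmat_def cross_mat_def tuple_mat_def zi kernel_sym xs_in z_in)
  qed (auto simp: Kmat_def cross_mat_def tuple_mat_def)
  have "?D - transpose_mat B * minv ?N * B = \<sigma>\<^sup>2 \<cdot>\<^sub>m 1\<^sub>m L + post_cov_noisy k \<sigma> xs t L z"
    unfolding post_cov_noisy_def using carriers(3) BIB by (intro eq_matI) auto
  then have "det (\<sigma>\<^sup>2 \<cdot>\<^sub>m 1\<^sub>m (t + L) + Kmat k xs (t + L)) = det ?N * det (\<sigma>\<^sup>2 \<cdot>\<^sub>m 1\<^sub>m L + post_cov_noisy k \<sigma> xs t L z)"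
    unfolding block using schur_complement_det[OF N(1,4) carriers(2) _ D, of "transpose_mat B"] carriers(2) by simp
  then show ?thesis
    unfolding det_scaled_one_plus[OF KT s0] det_scaled_one_plus[OF carriers(1) s0]
      det_scaled_one_plus[OF post_cov_carrier(2) s0]
    using s by (simp add: power_add)
qed

end

subsection \<open>Information gain and regret\<close>

text \<open>Apply \<open>ln (1 + x) \<le> x\<close> to each eigenvalue. The trace bound is used to
  see that information gains are bounded.\<close>

lemma ln_det_le_mtrace:
  assumes A: "A \<in> carrier_mat n n" "psd_mat A" and c: "0 \<le> c"
  shows "ln (det (1\<^sub>m n + c \<cdot>\<^sub>m A)) \<le> c * mtrace A"
proof -
  obtain d where d: "\<And>i. i < n \<Longrightarrow> eigenvalue A (d i)" and tr: "mtrace A = (\<Sum>i<n. d i)"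
    and det: "\<And>c. det (1\<^sub>m n + c \<cdot>\<^sub>m A) = (\<Prod>i<n. 1 + c * d i)"
    using symmetric_trace_det_eigenvalues[OF A(1)] A(2) unfolding psd_mat_def by metis
  have d0: "0 \<le> c * d i" if "i < n" for i
    using psd_mat_eigenvalue_nonneg[OF A d[OF that]] c by simp
  have "ln (det (1\<^sub>m n + c \<cdot>\<^sub>m A)) = (\<Sum>i<n. ln (1 + c * d i))"
    unfolding det
  proof (rule ln_prod)
    show "1 + c * d i \<noteq> 0" if "i \<in> {..<n}" for i using d0[of i] that by simp
  qed simp
  also have "\<dots> \<le> (\<Sum>i<n. c * d i)"
    by (intro sum_mono ln_add_one_self_le_self d0) simp
  finally show ?thesis by (simp add: tr sum_distrib_left)
qed

lemma psd_mat_mtrace_nonneg: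
  assumes "A \<in> carrier_mat n n" "psd_mat A"
  shows "0 \<le> mtrace A"
proof -
  have "mtrace (0\<^sub>m n n) \<le> mtrace A"
    using assms by (intro mtrace_mono[of _ n]) (auto simp: psd_mat_def scalar_prod_mult_mat_vec[of "0\<^sub>m n n" n n])
  then show ?thesis by (simp add: mtrace_def)
qed

text \<open>The supremum dominates its members only if the set is bounded above. Since the diagonal
  of the kernel is at most 1, the trace is at most \<open>T\<close>, which bounds every gain by
  \<open>T / (2 \<sigma>\<^sup>2)\<close>.\<close>

lemma info_gain_le_max_info_gain:
  assumes pd: "pd_kernel X k" and k1: "\<forall>x\<in>X. k x x \<le> 1" and xs: "\<forall>i\<in>{1..T}. xs i \<in> X"
  shows "info_gain k \<sigma> xs T \<le> max_info_gain k X \<sigma> T"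
  unfolding max_info_gain_def
proof (rule cSUP_upper)
  show "xs \<in> {xs. \<forall>i\<in>{1..T}. xs i \<in> X}" using xs by simp
  have "info_gain k \<sigma> ys T \<le> 1 / 2 * (1 / \<sigma>\<^sup>2 * real T)" if ys: "\<forall>i\<in>{1..T}. ys i \<in> X" for ys
  proof -
    \<comment> \<open>The tuple is empty here; the instance only provides facts about
      \<open>Kmat k ys T\<close>.\<close>
    interpret kernel_tuple X k ys T 0 ys
      by unfold_locales (use pd ys in auto)
    have "(\<Sum>i<T. k (ys (Suc i)) (ys (Suc i))) \<le> (\<Sum>i<T. 1)"
      by (rule sum_mono) (use k1 ys in auto)
    then have "mtrace (Kmat k ys T) \<le> real T" by (simp add: mtrace_def Kmat_def)
    then have "1 / \<sigma>\<^sup>2 * mtrace (Kmat k ys T) \<le> 1 / \<sigma>\<^sup>2 * real T"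
      by (intro mult_left_mono) auto
    then show ?thesis
      using ln_det_le_mtrace[OF carriers(1) psd_Kmat, of "1 / \<sigma>\<^sup>2"] by (simp add: info_gain_def)
  qed
  then show "bdd_above ((\<lambda>xs. info_gain k \<sigma> xs T) ` {xs. \<forall>i\<in>{1..T}. xs i \<in> X})"
    by (intro bdd_aboveI) auto
qed

section \<open>Splitting the queries into batches\<close>

lemma kernel_tuple_batch:
  assumes pd: "pd_kernel X k" and xs: "\<forall>i\<in>{1..N * L}. xs i \<in> X" and n: "n \<in> {1..N}"
  shows "kernel_tuple X k xs ((n - 1) * L) L (batch xs n L)"
proof
  obtain m where m: "n = Suc m" "Suc m \<le> N" using n by (cases n) auto
  then have le: "L + m * L \<le> N * L" using mult_le_mono1[of "Suc m" N L] by simp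
  show "xs (Suc i) \<in> X" if "i < (n - 1) * L" for i using xs that m le by auto
  show "batch xs n L j \<in> X" if "j < L" for j using xs that m le by (auto simp: batch_def)
qed (rule pd)

lemma sum_batches:
  "(\<Sum>t=1..N * L. g t) = (\<Sum>n=1..N. \<Sum>j<L. g ((n - 1) * L + Suc j))" for g :: "nat \<Rightarrow> real"
proof (induction N)
  case (Suc N)
  have "(\<Sum>t=1..Suc N * L. g t) = (\<Sum>t=1..N * L. g t) + (\<Sum>t=N * L + 1..N * L + L. g t)"
    using sum.ub_add_nat[of 1 "N * L" g L] by (simp add: add.commute)
  also have "(\<Sum>t=N * L + 1..N * L + L. g t) = (\<Sum>j<L. g (N * L + Suc j))"
    by (rule sum.reindex_bij_witness[of _ "\<lambda>j. N * L + Suc j" "\<lambda>t. t - Suc (N * L)"]) auto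
  finally show ?case using Suc.IH by simp
qed simp

text \<open>The chain rule for information gain: \<open>det_Kmat_append\<close> turns each batch
  into one factor of the full determinant. Both factors are positive, so the logarithm splits; the 2
  undoes the 1/2 in \<open>info_gain\<close>.\<close>

lemma sum_ln_det_batches:
  assumes pd: "pd_kernel X k" and \<sigma>: "0 < \<sigma>"
  shows "\<forall>i\<in>{1..N * L}. xs i \<in> X \<Longrightarrow>
    (\<Sum>n=1..N. ln (det (1\<^sub>m L + (1 / \<sigma>\<^sup>2) \<cdot>\<^sub>m post_cov_noisy k \<sigma> xs ((n - 1) * L) L (batch xs n L))))
      = 2 * info_gain k \<sigma> xs (N * L)"
proof (induction N)
  case 0
  show ?case by (simp add: info_gain_def Kmat_def det_dim_zero)
next
  case (Suc N)
  interpret kernel_tuple X k xs "N * L" L "batch xs (Suc N) L"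
    using kernel_tuple_batch[OF pd Suc.prems, of "Suc N"] by simp
  have IH: "(\<Sum>n=1..N. ln (det (1\<^sub>m L + (1 / \<sigma>\<^sup>2) \<cdot>\<^sub>m post_cov_noisy k \<sigma> xs ((n - 1) * L) L (batch xs n L))))
      = 2 * info_gain k \<sigma> xs (N * L)"
    by (rule Suc.IH) (use Suc.prems in auto)
  have "det (1\<^sub>m (N * L + L) + (1 / \<sigma>\<^sup>2) \<cdot>\<^sub>m Kmat k xs (N * L + L))
      = det (1\<^sub>m (N * L) + (1 / \<sigma>\<^sup>2) \<cdot>\<^sub>m K)
        * det (1\<^sub>m L + (1 / \<sigma>\<^sup>2) \<cdot>\<^sub>m post_cov_noisy k \<sigma> xs (N * L) L (batch xs (Suc N) L))"
    by (rule det_Kmat_append[OF \<sigma>]) (simp add: batch_def)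
  moreover have "0 < det (1\<^sub>m (N * L) + (1 / \<sigma>\<^sup>2) \<cdot>\<^sub>m K)"
    by (rule psd_mat_det_pos[OF carriers(1) psd_Kmat]) simp
  moreover have "0 < det (1\<^sub>m L + (1 / \<sigma>\<^sup>2) \<cdot>\<^sub>m post_cov_noisy k \<sigma> xs (N * L) L (batch xs (Suc N) L))"
    by (rule psd_mat_det_pos[OF post_cov_carrier(2) psd_post_cov_noisy[OF \<sigma>]]) simp
  ultimately have "2 * info_gain k \<sigma> xs (Suc N * L) = 2 * info_gain k \<sigma> xs (N * L)
      + ln (det (1\<^sub>m L + (1 / \<sigma>\<^sup>2) \<cdot>\<^sub>m post_cov_noisy k \<sigma> xs (N * L) L (batch xs (Suc N) L)))"
    by (simp add: info_gain_def ln_mult add.commute[of L])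
  then show ?case using IH by simp
qed

section \<open>Regret of a single batch\<close>

lemma post_cov_const_entry:
  assumes "invertible_mat (Kmat k xs t)" "i < L" "j < L"
  shows "post_cov k xs t L (\<lambda>_. x) $$ (i, j) = post_cov k xs t L (\<lambda>_. x) $$ (0, 0)"
proof -
  let ?B = "cross_mat k xs t L (\<lambda>_. x)" and ?I = "minv (Kmat k xs t)"
  have I: "?I \<in> carrier_mat t t" by (rule minv_props(1)) (use assms in \<open>auto simp: Kmat_def\<close>)
  have B: "?B \<in> carrier_mat t L" by (simp add: cross_mat_def)
  \<comment> \<open>For a constant tuple all columns of the cross matrix coincide, so no entry of
    the posterior covariance depends on its indices.\<close>
  have col: "Matrix.col ?B m = Matrix.vec t (\<lambda>i. k (xs (Suc i)) x)" if "m < L" for m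
    using that by (intro eq_vecI) (auto simp: cross_mat_def)
  have row: "Matrix.row (transpose_mat ?B * ?I) m = Matrix.row (transpose_mat ?B * ?I) 0" if "m < L" for m
    using that I B by (intro eq_vecI) (auto simp: col)
  show ?thesis
    unfolding post_cov_def using assms I B by (simp add: tuple_mat_def col row)
qed

text \<open>The all-ones weights in \<open>post_mean_error\<close> produce exactly the form that the
  acquisition function subtracts.\<close>

lemma (in kernel_tuple) sum_post_mean_le:
  assumes inv: "invertible_mat K" and f: "in_rkhs k X f"
  shows "(\<Sum>j<L. post_mean k xs f t (z j))
    \<le> (\<Sum>j<L. f (z j)) + rkhs_norm k X f * sqrt (ones_quad (post_cov k xs t L z))"
proof -
  let ?a = "Matrix.vec L (\<lambda>_. 1 :: real)"
  have "scalar_prod ?a (post_cov k xs t L z *\<^sub>v ?a) = ones_quad (post_cov k xs t L z)"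
    using post_cov_carrier(1) by (simp add: scalar_prod_mult_mat_vec[of _ L L] ones_quad_def)
  then show ?thesis
    using post_mean_error[OF inv f, of ?a] by (simp add: sum_subtractf)
qed

text \<open>For a constant tuple both square roots in \<open>acq\<close> equal the posterior
  standard deviation at \<open>x\<close>. Twice minus once leaves the posterior mean plus the norm
  times that deviation, an upper confidence bound for \<open>f x\<close>.\<close>

lemma le_acq_const:
  assumes pd: "pd_kernel X k" and f: "in_rkhs k X f" and x: "x \<in> X" and L: "0 < L"
    and xs: "\<And>i. i < (n - 1) * L \<Longrightarrow> xs (Suc i) \<in> X" and inv: "invertible_mat (Kmat k xs ((n - 1) * L))"
  shows "f x \<le> acq k f (rkhs_norm k X f) xs n L (\<lambda>_. x)"
proof -
  let ?t = "(n - 1) * L"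
  interpret kernel_tuple X k xs ?t L "\<lambda>_. x" by unfold_locales (use pd xs x in auto)
  define C where "C = post_cov k xs ?t L (\<lambda>_. x)"
  have C: "C \<in> carrier_mat L L" unfolding C_def by (rule post_cov_carrier)
  have entry: "C $$ (i, j) = C $$ (0, 0)" if "i < L" "j < L" for i j
    unfolding C_def by (rule post_cov_const_entry[OF inv that])
  have "mtrace C = (\<Sum>i<L. C $$ (0, 0))"
    using C unfolding mtrace_def by (intro sum.cong) (auto intro: entry)
  then have tr: "mtrace C / real L = C $$ (0, 0)" using L by simp
  have "ones_quad C = (\<Sum>i<L. \<Sum>j<L. C $$ (0, 0))"
    using C unfolding ones_quad_def by (intro sum.cong) (auto intro: entry)
  then have oq: "ones_quad C / (real L)\<^sup>2 = C $$ (0, 0)" using L by (simp add: power2_eq_square)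
  \<comment> \<open>The first unit vector selects one copy of \<open>x\<close>, reducing the tuple
    estimate to a single point.\<close>
  let ?e = "unit_vec L 0 :: real vec"
  have "scalar_prod ?e (C *\<^sub>v ?e) = C $$ (0, 0)" using C L by simp
  moreover have "(\<Sum>j<L. vec_index ?e j * c) = c" for c :: real
  proof -
    have "(\<Sum>j<L. vec_index ?e j * c) = (\<Sum>j<L. if j = 0 then c else 0)"
      by (intro sum.cong) auto
    then show ?thesis using L by simp
  qed
  ultimately have "\<bar>f x - post_mean k xs f ?t x\<bar> \<le> rkhs_norm k X f * sqrt (C $$ (0, 0))"
    using post_mean_error[OF inv f, of ?e] by (simp add: C_def)
  then show ?thesis
    using L unfolding acq_def Let_def C_def[symmetric] tr oq by simp
qed

text \<open>The constant tuple at \<open>x\<close> certifies that \<open>f x\<close> is at most the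
  acquisition value of the batch. After multiplication by \<open>L\<close>, the subtracted all-ones
  term cancels the error made in replacing posterior means by values of \<open>f\<close>, and only
  the trace term remains.\<close>

lemma batch_regret:
  assumes pd: "pd_kernel X k" and f: "in_rkhs k X f" and x: "x \<in> X" and L: "0 < L"
    and xs: "\<forall>i\<in>{1..N * L}. xs i \<in> X" and n: "n \<in> {1..N}"
    and inv: "invertible_mat (Kmat k xs ((n - 1) * L))"
    and opt: "acq k f (rkhs_norm k X f) xs n L (\<lambda>_. x) \<le> acq k f (rkhs_norm k X f) xs n L (batch xs n L)"
  shows "(\<Sum>j<L. f x - f (batch xs n L j))
    \<le> 2 * rkhs_norm k X f * sqrt (real L * mtrace (post_cov k xs ((n - 1) * L) L (batch xs n L)))"
proof -
  let ?t = "(n - 1) * L" and ?R = "rkhs_norm k X f"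
  interpret kernel_tuple X k xs ?t L "batch xs n L" by (rule kernel_tuple_batch[OF pd xs n])
  define C where "C = post_cov k xs ?t L (batch xs n L)"
  have "f x \<le> (1 / real L) * (\<Sum>j<L. post_mean k xs f ?t (batch xs n L j))
      + ?R * (2 * sqrt (mtrace C / real L) - sqrt (ones_quad C / (real L)\<^sup>2))"
    using le_acq_const[OF pd f x L xs_in inv] opt unfolding acq_def Let_def C_def by linarith
  then have "real L * f x \<le> real L * ((1 / real L) * (\<Sum>j<L. post_mean k xs f ?t (batch xs n L j))
      + ?R * (2 * sqrt (mtrace C / real L) - sqrt (ones_quad C / (real L)\<^sup>2)))"
    using L by (intro mult_left_mono) auto
  also have "\<dots> = (\<Sum>j<L. post_mean k xs f ?t (batch xs n L j))
      + 2 * ?R * (real L * sqrt (mtrace C / real L)) - ?R * (real L * sqrt (ones_quad C / (real L)\<^sup>2))"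
    using L by (simp add: algebra_simps)
  also have "real L * sqrt (ones_quad C / (real L)\<^sup>2) = sqrt (ones_quad C)"
    using L by (simp add: real_sqrt_divide)
  also have "real L * sqrt (mtrace C / real L) = sqrt (real L * mtrace C)"
    using L by (simp add: real_sqrt_divide real_sqrt_mult real_div_sqrt field_simps)
  also have "(\<Sum>j<L. post_mean k xs f ?t (batch xs n L j))
      \<le> (\<Sum>j<L. f (batch xs n L j)) + ?R * sqrt (ones_quad C)"
    unfolding C_def by (rule sum_post_mean_le[OF inv f])
  finally show ?thesis by (simp add: sum_subtractf C_def)
qed

lemma sum_sqrt_le:
  fixes y :: "'i \<Rightarrow> real"
  assumes "\<And>i. i \<in> I \<Longrightarrow> 0 \<le> y i"
  shows "(\<Sum>i\<in>I. sqrt (y i)) \<le> sqrt (real (card I) * (\<Sum>i\<in>I. y i))"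
proof (rule real_le_rsqrt)
  have "(\<Sum>i\<in>I. sqrt (y i))\<^sup>2 \<le> (\<Sum>i\<in>I. (sqrt (y i))\<^sup>2) * real (card I)"
    by (rule sum_squared_le_sum_of_squares)
  also have "(\<Sum>i\<in>I. (sqrt (y i))\<^sup>2) = (\<Sum>i\<in>I. y i)" using assms by simp
  finally show "(\<Sum>i\<in>I. sqrt (y i))\<^sup>2 \<le> real (card I) * (\<Sum>i\<in>I. y i)" by (simp add: mult.commute)
qed

theorem theorem2:
  fixes X :: "'a :: euclidean_space set"
    and k :: "'a \<Rightarrow> 'a \<Rightarrow> real"
    and f :: "'a \<Rightarrow> real"
    and xs :: "nat \<Rightarrow> 'a"
    and xstar :: 'a
    and N L :: nat
    and \<sigma> \<beta> C\<^sub>2 :: real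
    and T :: nat
  assumes "compact X"
    and "pd_kernel X k"
    and "\<forall>x\<in>X. k x x \<le> 1"
    and "in_rkhs k X f"
    and "N > 0" and "L > 0"
    and "\<forall>t\<in>{1..N * L}. xs t \<in> X"
    and "\<forall>t\<le>N * L. invertible_mat (Kmat k xs t)"
    and "\<forall>n\<in>{1..N}. \<forall>z. (\<forall>i<L. z i \<in> X) \<longrightarrow>
           acq k f (rkhs_norm k X f) xs n L z \<le> acq k f (rkhs_norm k X f) xs n L (batch xs n L)"
    and "xstar \<in> X" and "\<forall>x\<in>X. f x \<le> f xstar"
    and "\<sigma> > 0"
    and "\<beta> = Max ((\<lambda>n. spec_norm (post_cov_noisy k \<sigma> xs ((n - 1) * L) L (batch xs n L))) ` {1..N})"
    and "\<beta> > 0"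
    and "C\<^sub>2 = 8 * \<beta> / ln (1 + \<beta> / \<sigma>\<^sup>2)"
    and "T = N * L"
  shows "(\<Sum>t=1..T. f xstar - f (xs t)) \<le> rkhs_norm k X f * sqrt (real T * C\<^sub>2 * max_info_gain k X \<sigma> T)
         \<and> f xstar - Max ((\<lambda>t. f (xs t)) ` {1..T}) \<le> rkhs_norm k X f * sqrt (C\<^sub>2 * max_info_gain k X \<sigma> T / real T)"
proof -
  define R where "R = rkhs_norm k X f"
  define G where "G = max_info_gain k X \<sigma> T"
  define c where "c = \<beta> / ln (1 + \<beta> / \<sigma>\<^sup>2)"
  let ?C = "\<lambda>n. post_cov k xs ((n - 1) * L) L (batch xs n L)"
  let ?C' = "\<lambda>n. post_cov_noisy k \<sigma> xs ((n - 1) * L) L (batch xs n L)"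
  let ?ld = "\<lambda>n. ln (det (1\<^sub>m L + (1 / \<sigma>\<^sup>2) \<cdot>\<^sub>m ?C' n))"
  note pd = assms(2) and f = assms(4) and L = assms(6) and xs = assms(7) and \<sigma> = assms(12)
  have s: "0 < \<sigma>\<^sup>2" using \<sigma> by simp
  have R0: "0 \<le> R" unfolding R_def by (rule rkhs_norm_nonneg[OF pd f])
  have T0: "0 < real T" using assms(5,6,16) by simp
  have c0: "0 \<le> c" unfolding c_def using assms(14) s by (intro divide_nonneg_nonneg ln_ge_zero) auto
  have inv: "invertible_mat (Kmat k xs ((n - 1) * L))" if "n \<in> {1..N}" for n
  proof -
    have "(n - 1) * L \<le> N * L" using that by (intro mult_le_mono1) auto
    then show ?thesis using assms(8) by blast
  qed
  \<comment> \<open>The second fact holds because the product dominates the trace of a positive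
    semidefinite matrix; it makes the radicands below nonnegative.\<close>
  have trace: "mtrace (?C n) \<le> c * ?ld n" "0 \<le> c * ?ld n" if n: "n \<in> {1..N}" for n
  proof -
    interpret kernel_tuple X k xs "(n - 1) * L" L "batch xs n L"
      by (rule kernel_tuple_batch[OF pd xs n])
    have "spec_norm (?C' n) \<le> \<beta>" unfolding assms(13) by (rule Max_ge) (use n in auto)
    from mtrace_le_ln_det[OF post_cov_carrier(2) psd_post_cov_noisy[OF \<sigma>] this assms(14) s]
    have le: "mtrace (?C' n) \<le> c * ?ld n" unfolding c_def .
    show "mtrace (?C n) \<le> c * ?ld n" using mtrace_post_cov_le_noisy[OF inv[OF n] \<sigma>] le by simp
    show "0 \<le> c * ?ld n"
      using psd_mat_mtrace_nonneg[OF post_cov_carrier(2) psd_post_cov_noisy[OF \<sigma>]] le by linarith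
  qed
  have batch: "(\<Sum>j<L. f xstar - f (xs ((n - 1) * L + Suc j))) \<le> 2 * R * sqrt (real L * (c * ?ld n))"
    if n: "n \<in> {1..N}" for n
  proof -
    have "(\<Sum>j<L. f xstar - f (batch xs n L j)) \<le> 2 * R * sqrt (real L * mtrace (?C n))"
      unfolding R_def by (rule batch_regret[OF pd f assms(10) L xs n inv[OF n]]) (use assms(9,10) n in auto)
    also have "\<dots> \<le> 2 * R * sqrt (real L * (c * ?ld n))"
      using R0 trace[OF n] by (intro mult_left_mono real_sqrt_le_mono) auto
    finally show ?thesis by (simp add: batch_def)
  qed
  have "(\<Sum>t=1..T. f xstar - f (xs t)) \<le> (\<Sum>n=1..N. 2 * R * sqrt (real L * (c * ?ld n)))"
    unfolding assms(16) sum_batches by (intro sum_mono batch)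
  also have "\<dots> = 2 * R * (\<Sum>n=1..N. sqrt (real L * (c * ?ld n)))" by (simp add: sum_distrib_left)
  \<comment> \<open>Cauchy--Schwarz over the \<open>N\<close> batches; the factor \<open>N\<close>
    then combines with \<open>L\<close> to give \<open>T\<close>.\<close>
  also have "\<dots> \<le> 2 * R * sqrt (real (card {1..N}) * (\<Sum>n=1..N. real L * (c * ?ld n)))"
    using R0 trace(2) by (intro mult_left_mono sum_sqrt_le) auto
  also have "(\<Sum>n=1..N. real L * (c * ?ld n)) = real L * (c * (2 * info_gain k \<sigma> xs T))"
    unfolding assms(16) sum_ln_det_batches[OF pd \<sigma> xs, symmetric] by (simp add: sum_distrib_left)
  also have "real (card {1..N}) * (real L * (c * (2 * info_gain k \<sigma> xs T))) = real T * (2 * c) * info_gain k \<sigma> xs T"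
    by (simp add: assms(16))
  also have "2 * R * sqrt (real T * (2 * c) * info_gain k \<sigma> xs T) \<le> 2 * R * sqrt (real T * (2 * c) * G)"
    unfolding G_def using R0 T0 c0 xs assms(16)
    by (intro mult_left_mono real_sqrt_le_mono info_gain_le_max_info_gain[OF pd assms(3)]) auto
  \<comment> \<open>Moving the leading 2 under the root gives 4, and with the 2 from the information
    gain the factor 8 of \<open>C\<^sub>2\<close>.\<close>
  also have "\<dots> = R * sqrt (2\<^sup>2 * (real T * (2 * c) * G))"
    by (simp only: real_sqrt_mult[of "2\<^sup>2"]) simp
  also have "2\<^sup>2 * (real T * (2 * c) * G) = real T * C\<^sub>2 * G"
    unfolding assms(15) c_def by simp
  finally have regret: "(\<Sum>t=1..T. f xstar - f (xs t)) \<le> R * sqrt (real T * C\<^sub>2 * G)" .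
  let ?M = "Max ((\<lambda>t. f (xs t)) ` {1..T})"
  \<comment> \<open>The gap at the best queried point is at most the average gap, so the cumulative
    bound divided by \<open>T\<close> applies.\<close>
  have "real T * (f xstar - ?M) = (\<Sum>t=1..T. f xstar - ?M)" by simp
  also have "\<dots> \<le> (\<Sum>t=1..T. f xstar - f (xs t))"
    by (intro sum_mono diff_left_mono Max_ge) auto
  also note regret
  also have "R * sqrt (real T * C\<^sub>2 * G) = real T * (R * sqrt (C\<^sub>2 * G / real T))"
    using T0 by (simp add: real_sqrt_mult real_sqrt_divide field_simps)
  finally have "f xstar - ?M \<le> R * sqrt (C\<^sub>2 * G / real T)" using T0 by simp
  with regret show ?thesis unfolding R_def G_def by simp
qed

end
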